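(* Let $m\ge 3$. Suppose the available operations on $m$ qubits include $X_i,Z_i$ for all $i$, arbitrary $\mathit{CNOT}_{i\to j}$ for all $i\ne j$, the paired phase gates $S_iS_j^\dagger$ for all $i\ne j$, and the global Hadamard $H^{\otimes m}$. Then these gates generate the full $m$-qubit Clifford group up to global phase: $$\mathcal{C}_m/\mathrm{U}(1)\cong\big\langle X_i,Z_i,\mathit{CNOT}_{i\to j},S_iS_j^\dagger,H^{\otimes m}\big\rangle .$$
   Context: Indices $i,j$ range over $\{1,\dots,m\}$. $X_i,Z_i$ are the Pauli matrices acting on qubit $i$ of $(\mathbb{C}^2)^{\otimes m}$; $\mathit{CNOT}_{i\to j}$ is the controlled-NOT gate with control $i$ and target $j$; $S_i$ is the phase gate $\mathrm{diag}(1,\mathrm{i})$ (where $\mathrm{i}=\sqrt{-1}$) on qubit $i$; $H$ is the single-qubit Hadamard gate and $H^{\otimes m}$ applies it to all $m$ qubits. The $m$-qubit Clifford group $\mathcal{C}_m$ is the normaliser, in the unitary group of $(\mathbb{C}^2)^{\otimes m}$, of the Pauli group $\mathcal{P}_m=\langle X_i,Z_i\rangle_{i=1}^m$. $\mathrm{U}(1)=\{e^{\mathrm{i}\theta}I:\theta\in\mathbb{R}\}$ are the global phases; "up to global phase" means that the images of the listed gates in $\mathcal{C}_m/\mathrm{U}(1)$ generate $\mathcal{C}_m/\mathrm{U}(1)$.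
   Formalization: The Pauli group is taken to be generated by the scalar iI together with all X_i, Z_i; with X_i, Z_i alone, conjugation by S_iS_j^† sends X_i to iX_iZ_i outside the group, so the listed gates would not lie in its normaliser. *)

theory Defs
  imports "HOL-Analysis.Analysis" "HOL-Algebra.Group_Action" "HOL-Algebra.Generated_Groups"
begin

section \<open>Operators on finitely many qubits\<close>

text \<open>
  Qubits are labelled by a finite type \<open>'m\<close>, so their number is \<open>CARD('m)\<close>. The computational
  basis of the tensor product of one two-dimensional space per qubit is indexed by the bit
  assignments \<open>'m \<Rightarrow> bool\<close>, with \<open>False\<close> and \<open>True\<close> for the basis vectors 0 and 1 of a
  single qubit. The entry \<open>A $ a $ b\<close> is in row \<open>a\<close> and column \<open>b\<close>.
\<close>

type_synonym qubit_mat = "complex ^ bool ^ bool"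
type_synonym 'm qmat = "complex ^ ('m \<Rightarrow> bool) ^ ('m \<Rightarrow> bool)"

definition dagger :: "complex ^ 'n ^ 'n \<Rightarrow> complex ^ 'n ^ 'n" where
  "dagger A = (\<chi> a b. cnj (A $ b $ a))"

definition unitary_group :: "(complex ^ 'n ^ 'n) monoid" where
  "unitary_group =
     \<lparr>carrier = {A. dagger A ** A = mat 1 \<and> A ** dagger A = mat 1}, mult = (**), one = mat 1\<rparr>"

definition pauli_x :: qubit_mat where
  "pauli_x = (\<chi> a b. if a \<noteq> b then 1 else 0)"

definition pauli_z :: qubit_mat where
  "pauli_z = (\<chi> a b. if a = b then (if a then -1 else 1) else 0)"

definition phase_s :: qubit_mat where
  "phase_s = (\<chi> a b. if a = b then (if a then \<i> else 1) else 0)"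

definition hadamard :: qubit_mat where
  "hadamard = (\<chi> a b. (if a \<and> b then -1 else 1) / complex_of_real (sqrt 2))"

text \<open>The operator acting as \<open>U\<close> on qubit \<open>i\<close> and as the identity on all others.\<close>

definition on_qubit :: "'m::finite \<Rightarrow> qubit_mat \<Rightarrow> 'm qmat" where
  "on_qubit i U = (\<chi> a b. if \<forall>k. k \<noteq> i \<longrightarrow> a k = b k then U $ a i $ b i else 0)"

text \<open>The tensor power of \<open>U\<close> with one factor per qubit.\<close>

definition on_all_qubits :: "qubit_mat \<Rightarrow> ('m::finite) qmat" where
  "on_all_qubits U = (\<chi> a b. \<Prod>i\<in>UNIV. U $ a i $ b i)"

text \<open>Control \<open>i\<close>, target \<open>j\<close>; only meant for \<open>i \<noteq> j\<close>.\<close>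

definition cnot :: "'m::finite \<Rightarrow> 'm \<Rightarrow> 'm qmat" where
  "cnot i j = (\<chi> a b. if a = b(j := (b j \<noteq> b i)) then 1 else 0)"


section \<open>Pauli and Clifford groups\<close>

text \<open>
  The scalar \<open>\<i>\<close> is a generator of the Pauli group, as usual. The matrices \<open>X\<^sub>i\<close>, \<open>Z\<^sub>i\<close> alone
  generate only real matrices, so conjugation by the phase gate on qubit \<open>i\<close>, which sends
  \<open>X\<^sub>i\<close> to \<open>Y\<^sub>i = \<i> X\<^sub>i Z\<^sub>i\<close>, would not preserve the group they generate. Enlarging the scalars
  further, to all global phases, does not change the normaliser.
\<close>

definition pauli_group :: "('m::finite) qmat set" where
  "pauli_group = generate unitary_group
     ({mat \<i>} \<union> range (\<lambda>i. on_qubit i pauli_x) \<union> range (\<lambda>i. on_qubit i pauli_z))"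

definition clifford_group :: "('m::finite) qmat monoid" where
  "clifford_group = unitary_group\<lparr>carrier := normalizer unitary_group pauli_group\<rparr>"

definition global_phases :: "('m::finite) qmat set" where
  "global_phases = {mat (cis \<theta>) | \<theta>. True}"

definition available_gates :: "('m::finite) qmat set" where
  "available_gates =
     {on_qubit i pauli_x | i. True} \<union> {on_qubit i pauli_z | i. True}
     \<union> {cnot i j | i j. i \<noteq> j}
     \<union> {on_qubit i phase_s ** dagger (on_qubit j phase_s) | i j. i \<noteq> j}
     \<union> {on_all_qubits hadamard}"


section \<open>The quotient by global phases is a group\<close>

lemma dagger_dagger [simp]: "dagger (dagger A) = A"
  by (simp add: dagger_def vec_eq_iff)

lemma dagger_mult: "dagger (A ** B) = dagger B ** dagger A"
  by (simp add: dagger_def matrix_matrix_mult_def vec_eq_iff mult.commute)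

lemma dagger_mat [simp]: "dagger (mat c) = mat (cnj c)"
  by (simp add: dagger_def mat_def vec_eq_iff)

lemma mat_mult_nth: "(mat c ** A) $ a $ b = c * (A $ a $ b)" for A :: "complex ^ 'n ^ 'n"
  by (simp add: matrix_matrix_mult_def mat_def if_distrib if_distribR cong: if_cong)

lemma mult_mat_nth: "(A ** mat c) $ a $ b = c * (A $ a $ b)" for A :: "complex ^ 'n ^ 'n"
  by (simp add: matrix_matrix_mult_def mat_def if_distrib if_distribR mult.commute cong: if_cong)

lemma mat_mult_commute: "mat c ** A = A ** mat c" for A :: "complex ^ 'n ^ 'n"
  by (simp add: vec_eq_iff mat_mult_nth mult_mat_nth)

lemma mat_mult_mat: "mat c ** mat d = (mat (c * d) :: complex ^ 'n ^ 'n)"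
  by (simp add: vec_eq_iff mat_mult_nth) (simp add: mat_def)

lemma unitary_group_simps [simp]:
  "A \<in> carrier unitary_group \<longleftrightarrow> dagger A ** A = mat 1 \<and> A ** dagger A = mat 1"
  "A \<otimes>\<^bsub>unitary_group\<^esub> B = A ** B"
  "\<one>\<^bsub>unitary_group\<^esub> = mat 1"
  by (simp_all add: unitary_group_def)

lemma group_unitary_group: "group (unitary_group :: (complex ^ 'n ^ 'n) monoid)"
proof (rule groupI)
  fix A B :: "complex ^ 'n ^ 'n"
  assume A: "A \<in> carrier unitary_group" and B: "B \<in> carrier unitary_group"
  have "dagger (A ** B) ** (A ** B) = dagger B ** (dagger A ** A) ** B"
    by (simp only: dagger_mult matrix_mul_assoc)
  moreover have "(A ** B) ** dagger (A ** B) = A ** (B ** dagger B) ** dagger A"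
    by (simp only: dagger_mult matrix_mul_assoc)
  ultimately show "A \<otimes>\<^bsub>unitary_group\<^esub> B \<in> carrier unitary_group"
    using A B by simp
  show "\<exists>C\<in>carrier unitary_group. C \<otimes>\<^bsub>unitary_group\<^esub> A = \<one>\<^bsub>unitary_group\<^esub>"
    using A by (intro bexI[of _ "dagger A"]) auto
qed (auto simp: matrix_mul_assoc)

lemma pauli_generators_unitary:
  "mat \<i> \<in> carrier (unitary_group :: ('m::finite) qmat monoid)"
  "on_qubit (i::'m) pauli_x \<in> carrier unitary_group"
  "on_qubit (i::'m) pauli_z \<in> carrier unitary_group"
proof -
  show "mat \<i> \<in> carrier (unitary_group :: 'm qmat monoid)"
    by (simp add: mat_mult_mat)
  have herm: "dagger (on_qubit i pauli_x) = on_qubit i pauli_x"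
    "dagger (on_qubit i pauli_z) = on_qubit i pauli_z"
    by (auto simp: dagger_def on_qubit_def pauli_x_def pauli_z_def vec_eq_iff)
  have sq: "on_qubit i U ** on_qubit i U = mat 1" if U: "U ** U = mat 1" for U
  proof -
    have "(\<Sum>c\<in>UNIV. on_qubit i U $ a $ c * on_qubit i U $ c $ b) = mat 1 $ a $ b" for a b
    proof -
      have "(\<Sum>c\<in>UNIV. on_qubit i U $ a $ c * on_qubit i U $ c $ b)
          = (\<Sum>c\<in>range (\<lambda>x. a(i := x)). on_qubit i U $ a $ c * on_qubit i U $ c $ b)"
      proof (rule sum.mono_neutral_right)
        show "\<forall>c\<in>UNIV - range (\<lambda>x. a(i := x)).
            on_qubit i U $ a $ c * on_qubit i U $ c $ b = 0"
        proof
          fix c assume c: "c \<in> UNIV - range (\<lambda>x. a(i := x))"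
          have "\<not> (\<forall>k. k \<noteq> i \<longrightarrow> a k = c k)"
          proof
            assume "\<forall>k. k \<noteq> i \<longrightarrow> a k = c k"
            hence "c = a(i := c i)" by (simp add: fun_eq_iff)
            thus False using c by blast
          qed
          hence "on_qubit i U $ a $ c = 0"
            by (auto simp: on_qubit_def)
          thus "on_qubit i U $ a $ c * on_qubit i U $ c $ b = 0"
            by simp
        qed
      qed auto
      also have "\<dots> = (\<Sum>x\<in>UNIV. on_qubit i U $ a $ (a(i := x)) * on_qubit i U $ (a(i := x)) $ b)"
        by (subst sum.reindex) (auto simp: inj_on_def fun_eq_iff split: if_splits)
      also have "\<dots> = (if \<forall>k. k \<noteq> i \<longrightarrow> a k = b k then (U ** U) $ a i $ b i else 0)"
      proof (cases "\<forall>k. k \<noteq> i \<longrightarrow> a k = b k")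
        case False
        hence "on_qubit i U $ (a(i := x)) $ b = 0" for x
          by (auto simp: on_qubit_def)
        thus ?thesis using False by (simp only: mult_zero_right sum.neutral_const if_False)
      qed (simp add: on_qubit_def matrix_matrix_mult_def)
      also have "\<dots> = mat 1 $ a $ b"
        unfolding U by (auto simp: mat_def fun_eq_iff)
      finally show ?thesis .
    qed
    thus ?thesis by (simp add: vec_eq_iff matrix_matrix_mult_def)
  qed
  have "pauli_x ** pauli_x = mat 1" "pauli_z ** pauli_z = mat 1"
    by (auto simp: pauli_x_def pauli_z_def matrix_matrix_mult_def mat_def vec_eq_iff UNIV_bool)
  thus "on_qubit i pauli_x \<in> carrier unitary_group" "on_qubit i pauli_z \<in> carrier unitary_group"
    by (simp_all add: herm sq)
qed

lemma subgroup_pauli_group: "subgroup (pauli_group :: ('m::finite) qmat set) unitary_group"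
  unfolding pauli_group_def using pauli_generators_unitary
  by (intro group.generate_is_subgroup[OF group_unitary_group]) blast

lemma subgroup_clifford:
  "subgroup (normalizer unitary_group (pauli_group :: ('m::finite) qmat set)) unitary_group"
  by (rule group.normalizer_imp_subgroup[OF group_unitary_group
        subgroup.subset[OF subgroup_pauli_group]])

lemma group_clifford_group: "group (clifford_group :: ('m::finite) qmat monoid)"
  unfolding clifford_group_def
  by (rule group.subgroup_imp_group[OF group_unitary_group subgroup_clifford])

lemma inv_unitary_group: "A \<in> carrier unitary_group \<Longrightarrow> inv\<^bsub>unitary_group\<^esub> A = dagger A"
  by (rule group.inv_equality[OF group_unitary_group]) auto

lemma mem_clifford_group_iff:
  fixes A :: "('m::finite) qmat"
  shows "A \<in> carrier clifford_group \<longleftrightarrow>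
    A \<in> carrier unitary_group \<and> (\<lambda>P. A ** P ** dagger A) ` pauli_group = pauli_group"
proof -
  have "A <#\<^bsub>unitary_group\<^esub> pauli_group #>\<^bsub>unitary_group\<^esub> inv\<^bsub>unitary_group\<^esub> A
      = (\<lambda>P. A ** P ** dagger A) ` pauli_group" if "A \<in> carrier unitary_group"
    using inv_unitary_group[OF that] by (auto simp: l_coset_def r_coset_def)
  thus ?thesis
    using subgroup.subset[OF subgroup_pauli_group]
    by (auto simp: clifford_group_def normalizer_def stabilizer_def)
qed

lemma normal_global_phases:
  "(global_phases :: ('m::finite) qmat set) \<lhd> clifford_group"
proof -
  have U: "mat (cis \<theta>) \<in> carrier (unitary_group :: 'm qmat monoid)" for \<theta>
    by (simp add: mat_mult_mat cis_cnj cis_mult)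
  have C: "mat (cis \<theta>) \<in> carrier (clifford_group :: 'm qmat monoid)" for \<theta>
  proof -
    have "mat (cis \<theta>) ** P ** dagger (mat (cis \<theta>)) = P" for P :: "'m qmat"
      using U[of \<theta>] by (simp add: mat_mult_commute[of _ P] flip: matrix_mul_assoc)
    thus ?thesis using U[of \<theta>] by (simp add: mem_clifford_group_iff)
  qed
  have sub: "subgroup (global_phases :: 'm qmat set) unitary_group"
  proof (rule group.subgroupI[OF group_unitary_group])
    fix A :: "'m qmat" assume "A \<in> global_phases"
    then obtain \<theta> where "A = mat (cis \<theta>)" by (auto simp: global_phases_def)
    thus "inv\<^bsub>unitary_group\<^esub> A \<in> global_phases"
      using inv_unitary_group[OF U[of \<theta>]] by (auto simp: global_phases_def cis_cnj)
  next
    fix A B :: "'m qmat" assume "A \<in> global_phases" "B \<in> global_phases"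
    thus "A \<otimes>\<^bsub>unitary_group\<^esub> B \<in> global_phases"
      by (auto simp: global_phases_def mat_mult_mat cis_mult)
  qed (use U in \<open>auto simp: global_phases_def simp del: unitary_group_simps\<close>)
  have "subgroup (global_phases :: 'm qmat set) clifford_group"
    unfolding clifford_group_def
    by (rule group.subgroup_incl[OF group_unitary_group sub subgroup_clifford])
      (use C in \<open>auto simp: global_phases_def clifford_group_def\<close>)
  thus ?thesis
    by (intro group.normalI group_clifford_group)
      (auto simp: r_coset_def l_coset_def global_phases_def clifford_group_def mat_mult_commute)
qed

lemma group_clifford_mod_phases:
  "group ((clifford_group :: ('m::finite) qmat monoid) Mod global_phases)"
  by (rule normal.factorgroup_is_group[OF normal_global_phases])

end

theory Submission
  imports Defs
begin

text \<open>
  For a Pauli operator \<open>P\<close> with \<open>P\<^sup>2 = 1\<close>, conjugation by \<open>(1 + \<i>P) / \<surd>2\<close> acts on Pauli operators up to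
  phase as the symplectic transvection along \<open>P\<close>. For \<open>P = Z\<^sub>i\<close> this rotation is a phase gate, which
  the gates generate because three qubits carry an odd number, seven, of nonzero linear forms.
  Conjugating by the global Hadamard and by CNOTs gives the rotations for \<open>X\<^sub>i\<close> and \<open>Z\<^sub>i Z\<^sub>j\<close>, and
  if \<open>P\<close> and \<open>Q\<close> anticommute, the rotation for \<open>P Q\<close> (up to phase) arises by conjugating one for
  \<open>P\<close> with one for \<open>Q\<close>; so all rotations are generated. Transvections move the images of \<open>X\<^sub>i, Z\<^sub>i\<close>
  under any Clifford operator back to \<open>X\<^sub>i, Z\<^sub>i\<close>, one qubit at a time. What is left commutes up to
  sign with every \<open>X\<^sub>i\<close> and \<open>Z\<^sub>i\<close> and hence is a Pauli operator up to phase.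
\<close>

section \<open>Complex multiples of matrices, used to carry phases\<close>

definition smul :: "complex \<Rightarrow> complex ^ 'n ^ 'n \<Rightarrow> complex ^ 'n ^ 'n" where
  "smul c A = (\<chi> a b. c * A $ a $ b)"

lemma smul_nth [simp]: "smul c A $ a $ b = c * A $ a $ b"
  by (simp add: smul_def)

lemma smul_smul [simp]: "smul c (smul d A) = smul (c * d) A"
  by (simp add: vec_eq_iff mult.assoc)

lemma smul_one [simp]: "smul 1 A = A"
  by (simp add: vec_eq_iff)

lemma smul_mult_left [simp]: "smul c A ** B = smul c (A ** B)"
  by (simp add: vec_eq_iff matrix_matrix_mult_def sum_distrib_left mult.assoc)

lemma smul_mult_right [simp]: "A ** smul c B = smul c (A ** B)"
  by (simp add: vec_eq_iff matrix_matrix_mult_def sum_distrib_left mult_ac)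

lemma dagger_smul [simp]: "dagger (smul c A) = smul (cnj c) (dagger A)"
  by (simp add: dagger_def vec_eq_iff)

lemma mat_eq_smul: "mat c = smul c (mat 1)"
  by (simp add: vec_eq_iff mat_def)

lemma smul_add: "smul c (A + B) = smul c A + smul c B"
  by (simp add: vec_eq_iff distrib_left)

lemma smul_left_eqD:
  assumes "smul c A = smul d A" "A \<noteq> 0"
  shows "c = d"
proof -
  obtain a b where "A $ a $ b \<noteq> 0"
    using assms(2) by (auto simp: vec_eq_iff)
  moreover have "smul c A $ a $ b = smul d A $ a $ b"
    using assms(1) by simp
  ultimately show ?thesis by simp
qed

lemma unitary_mult:
  assumes "A \<in> carrier unitary_group" "B \<in> carrier unitary_group"
  shows "A ** B \<in> carrier unitary_group"
  using group.is_monoid[OF group_unitary_group, THEN monoid.m_closed, OF assms]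
  by (simp only: unitary_group_simps(2))

lemma smul_cis_unitary:
  assumes "A \<in> carrier unitary_group"
  shows "smul (cis t) A \<in> carrier unitary_group"
  using assms by (simp add: cis_cnj cis_mult)

section \<open>Tensor products of single-qubit operators\<close>

definition tensor :: "('m::finite \<Rightarrow> qubit_mat) \<Rightarrow> 'm qmat" where
  "tensor U = (\<chi> a b. \<Prod>k\<in>UNIV. U k $ a k $ b k)"

lemma sum_prod_UNIV:
  fixes f :: "'m::finite \<Rightarrow> 'b::finite \<Rightarrow> complex"
  shows "(\<Sum>c\<in>UNIV. \<Prod>k\<in>UNIV. f k (c k)) = (\<Prod>k\<in>UNIV. \<Sum>x\<in>UNIV. f k x)"
  using prod_sum_PiE[of "UNIV::'m set" "\<lambda>_. UNIV :: 'b set" f] by (simp add: PiE_UNIV_domain)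

text \<open>The sum over intermediate bit assignments of a product over qubits factors into one sum
  per qubit, and each factor is an entry of a single-qubit product.\<close>

lemma tensor_mult: "tensor U ** tensor V = tensor (\<lambda>k. U k ** V k)"
proof -
  have "(\<Sum>c\<in>UNIV. \<Prod>k\<in>UNIV. U k $ a k $ c k * V k $ c k $ b k)
      = (\<Prod>k\<in>UNIV. \<Sum>x\<in>UNIV. U k $ a k $ x * V k $ x $ b k)" for a b
    by (rule sum_prod_UNIV)
  thus ?thesis
    by (simp add: vec_eq_iff tensor_def matrix_matrix_mult_def flip: prod.distrib)
qed

lemma dagger_tensor: "dagger (tensor U) = tensor (\<lambda>k. dagger (U k))"
  by (simp add: vec_eq_iff tensor_def dagger_def)

lemma tensor_smul: "tensor (\<lambda>k. smul (c k) (U k)) = smul (\<Prod>k\<in>UNIV. c k) (tensor U)"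
  by (simp add: vec_eq_iff tensor_def prod.distrib)

lemma tensor_one: "tensor (\<lambda>_. mat 1) = mat 1"
  by (auto simp: vec_eq_iff tensor_def mat_def fun_eq_iff)

lemma tensor_unitary:
  assumes "\<And>k. U k \<in> carrier unitary_group"
  shows "tensor U \<in> carrier unitary_group"
  using assms by (simp add: dagger_tensor tensor_mult tensor_one)

lemma on_qubit_eq_tensor: "on_qubit i U = tensor (\<lambda>k. if k = i then U else mat 1)"
proof -
  have "(\<Prod>k\<in>UNIV. (if k = i then U else mat 1) $ a k $ b k)
      = U $ a i $ b i * (\<Prod>k\<in>UNIV - {i}. mat 1 $ a k $ b k)" for a b
    by (subst prod.remove[of _ i]) auto
  moreover have "(\<Prod>k\<in>UNIV - {i}. (mat 1 :: qubit_mat) $ a k $ b k)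
      = (if \<forall>k. k \<noteq> i \<longrightarrow> a k = b k then 1 else 0)" for a b
    by (auto simp: mat_def)
  ultimately have "(\<Prod>k\<in>UNIV. (if k = i then U else mat 1) $ a k $ b k)
      = (if \<forall>k. k \<noteq> i \<longrightarrow> a k = b k then U $ a i $ b i else 0)" for a b
    by (simp only: mult_1_right mult_zero_right if_distrib[of "(*) (U $ a i $ b i)"])
  thus ?thesis
    by (simp add: vec_eq_iff tensor_def on_qubit_def)
qed

lemma on_all_qubits_eq_tensor: "on_all_qubits U = tensor (\<lambda>_. U)"
  by (simp add: vec_eq_iff tensor_def on_all_qubits_def)

section \<open>Pauli operators\<close>

text \<open>A pair \<open>(x, z)\<close> of bits stands for \<open>X\<^sup>x Z\<^sup>z\<close>.\<close>

fun pauli1 :: "bool \<times> bool \<Rightarrow> qubit_mat" where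
  "pauli1 (x, z) = (\<chi> a b. if a = (b \<noteq> x) then (if z \<and> b then -1 else 1) else 0)"

abbreviation I1 :: "bool \<times> bool" where "I1 \<equiv> (False, False)"
abbreviation X1 :: "bool \<times> bool" where "X1 \<equiv> (True, False)"
abbreviation Z1 :: "bool \<times> bool" where "Z1 \<equiv> (False, True)"

fun padd :: "bool \<times> bool \<Rightarrow> bool \<times> bool \<Rightarrow> bool \<times> bool" where
  "padd (x, z) (x', z') = (x \<noteq> x', z \<noteq> z')"

text \<open>The cost \<open>(-1)^(z x')\<close> of moving \<open>Z^z\<close> past
  \<open>X^x'\<close>, which brings a product back into the order X before Z.\<close>

fun psign :: "bool \<times> bool \<Rightarrow> bool \<times> bool \<Rightarrow> complex" where
  "psign (x, z) (x', z') = (if z \<and> x' then -1 else 1)"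

text \<open>The symplectic form on bit pairs over the field of two elements.\<close>

fun anti :: "bool \<times> bool \<Rightarrow> bool \<times> bool \<Rightarrow> bool" where
  "anti (x, z) (x', z') = ((z \<and> x') \<noteq> (z' \<and> x))"

lemma pauli1_mult: "pauli1 p ** pauli1 q = smul (psign p q) (pauli1 (padd p q))"
  by (cases p; cases q) (auto simp: vec_eq_iff matrix_matrix_mult_def UNIV_bool)

lemma pauli1_dagger: "dagger (pauli1 p) = smul (psign p p) (pauli1 p)"
  by (cases p) (auto simp: vec_eq_iff dagger_def)

lemma pauli1_one: "pauli1 I1 = mat 1"
  by (auto simp: vec_eq_iff mat_def)

lemma pauli1_x: "pauli1 X1 = pauli_x"
  by (auto simp: vec_eq_iff pauli_x_def)

lemma pauli1_z: "pauli1 Z1 = pauli_z"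
  by (auto simp: vec_eq_iff pauli_z_def)

definition pauli :: "('m::finite \<Rightarrow> bool \<times> bool) \<Rightarrow> 'm qmat" where
  "pauli v = tensor (\<lambda>k. pauli1 (v k))"

definition vadd :: "('m \<Rightarrow> bool \<times> bool) \<Rightarrow> ('m \<Rightarrow> bool \<times> bool) \<Rightarrow> 'm \<Rightarrow> bool \<times> bool" where
  "vadd u v = (\<lambda>k. padd (u k) (v k))"

definition vsign :: "('m::finite \<Rightarrow> bool \<times> bool) \<Rightarrow> ('m \<Rightarrow> bool \<times> bool) \<Rightarrow> complex" where
  "vsign u v = (\<Prod>k\<in>UNIV. psign (u k) (v k))"

text \<open>The symplectic form on bit vectors, kept as a sign so that its bilinearity becomes
  multiplicativity.\<close>

definition comm :: "('m::finite \<Rightarrow> bool \<times> bool) \<Rightarrow> ('m \<Rightarrow> bool \<times> bool) \<Rightarrow> complex" where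
  "comm u v = (\<Prod>k\<in>UNIV. if anti (u k) (v k) then -1 else 1)"

definition single :: "'m \<Rightarrow> bool \<times> bool \<Rightarrow> 'm \<Rightarrow> bool \<times> bool" where
  "single i p = (\<lambda>_. I1)(i := p)"

lemma prod_pm_one:
  fixes f :: "'a \<Rightarrow> complex"
  assumes "\<And>k. f k = 1 \<or> f k = -1"
  shows "(\<Prod>k\<in>S. f k) = 1 \<or> (\<Prod>k\<in>S. f k) = -1"
proof (induction S rule: infinite_finite_induct)
  case (insert x F)
  thus ?case using assms[of x] by auto
qed auto

lemma vsign_cases: "vsign u v = 1 \<or> vsign u v = -1"
proof -
  have "psign p q = 1 \<or> psign p q = -1" for p q
    by (cases p; cases q) auto
  thus ?thesis unfolding vsign_def by (intro prod_pm_one)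
qed

lemma comm_cases: "comm u v = 1 \<or> comm u v = -1"
  unfolding comm_def by (intro prod_pm_one) auto

lemma comm_commute: "comm u v = comm v u"
proof -
  have "anti p q = anti q p" for p q by (cases p; cases q) auto
  thus ?thesis by (simp add: comm_def)
qed

lemma comm_self [simp]: "comm u u = 1"
proof -
  have "\<not> anti p p" for p by (cases p) auto
  thus ?thesis by (simp add: comm_def)
qed

lemma comm_add: "comm u (vadd v w) = comm u v * comm u w"
proof -
  have "(if anti p (padd q r) then -1 else 1 :: complex)
      = (if anti p q then -1 else 1) * (if anti p r then -1 else 1)" for p q r
    by (cases p; cases q; cases r) auto
  thus ?thesis by (simp add: comm_def vadd_def flip: prod.distrib)
qed

lemma comm_eq_vsign: "comm u v = vsign u v * vsign v u"
proof -
  have "(if anti p q then -1 else 1 :: complex) = psign p q * psign q p" for p q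
    by (cases p; cases q) auto
  thus ?thesis by (simp add: comm_def vsign_def flip: prod.distrib)
qed

lemma comm_eq_one: "(\<And>k. u k = I1 \<or> v k = I1) \<Longrightarrow> comm u v = 1"
proof -
  assume *: "\<And>k. u k = I1 \<or> v k = I1"
  have "\<not> anti (u k) (v k)" for k
    using *[of k] by (cases "u k"; cases "v k") auto
  thus ?thesis by (simp add: comm_def)
qed

lemma comm_supported:
  assumes "\<And>k. k \<noteq> i \<Longrightarrow> u k = I1 \<or> v k = I1"
  shows "comm u v = (if anti (u i) (v i) then -1 else 1)"
proof -
  have "\<not> anti (u k) (v k)" if "k \<noteq> i" for k
    using assms[OF that] by (cases "u k"; cases "v k") auto
  thus ?thesis
    unfolding comm_def by (subst prod.remove[of _ i]) auto
qed

lemma comm_single: "comm v (single i p) = (if anti (v i) p then -1 else 1)"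
  by (subst comm_supported[of i]) (auto simp: single_def)

lemma vadd_commute: "vadd u v = vadd v u"
proof -
  have "padd p q = padd q p" for p q by (cases p; cases q) auto
  thus ?thesis by (simp add: vadd_def)
qed

lemma vadd_cancel: "vadd u (vadd u v) = v"
proof -
  have "padd p (padd p q) = q" for p q by (cases p; cases q) auto
  thus ?thesis by (simp add: vadd_def)
qed

lemma vadd_self: "vadd u u = (\<lambda>_. I1)"
proof -
  have "padd p p = I1" for p by (cases p) auto
  thus ?thesis by (simp add: vadd_def)
qed

lemma pauli_mult: "pauli u ** pauli v = smul (vsign u v) (pauli (vadd u v))"
  by (simp add: pauli_def tensor_mult pauli1_mult tensor_smul vsign_def vadd_def)

lemma pauli_commute: "pauli u ** pauli v = smul (comm u v) (pauli v ** pauli u)"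
  using vsign_cases[of v u]
  by (auto simp: pauli_mult comm_eq_vsign vadd_commute[of u v])

lemma pauli_zero: "pauli (\<lambda>_. I1) = mat 1"
  by (simp only: pauli_def pauli1_one tensor_one)

lemma pauli_square: "pauli u ** pauli u = smul (vsign u u) (mat 1)"
  by (simp add: pauli_mult vadd_self pauli_zero)

lemma pauli_dagger: "dagger (pauli u) = smul (vsign u u) (pauli u)"
  by (simp add: pauli_def dagger_tensor pauli1_dagger tensor_smul vsign_def)

lemma pauli_unitary: "pauli u \<in> carrier unitary_group"
  using vsign_cases[of u u] by (auto simp: pauli_dagger pauli_square)

lemma pauli_single: "pauli (single i p) = on_qubit i (pauli1 p)"
  unfolding pauli_def on_qubit_eq_tensor single_def
  by (rule arg_cong[of _ _ tensor]) (auto simp: fun_eq_iff pauli1_one simp del: pauli1.simps)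

lemma pauli_single_x: "pauli (single i X1) = on_qubit i pauli_x"
  by (simp only: pauli_single pauli1_x)

lemma pauli_single_z: "pauli (single i Z1) = on_qubit i pauli_z"
  by (simp only: pauli_single pauli1_z)

lemma mat_i_in_pauli_group: "(mat \<i> :: ('m::finite) qmat) \<in> pauli_group"
  unfolding pauli_group_def by (rule generate.incl) blast

lemma pauli_group_mult: "A \<in> pauli_group \<Longrightarrow> B \<in> pauli_group \<Longrightarrow> A ** B \<in> pauli_group"
  using subgroup.m_closed[OF subgroup_pauli_group] by (simp only: unitary_group_simps(2))

lemma pauli_group_one: "mat 1 \<in> pauli_group"
  using subgroup.one_closed[OF subgroup_pauli_group] by (simp only: unitary_group_simps(3))

lemma fourth_root_of_unity:
  fixes c :: complex
  assumes "c ^ 4 = 1"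
  shows "c = 1 \<or> c = -1 \<or> c = \<i> \<or> c = -\<i>"
proof -
  have "(c\<^sup>2 - 1) * (c\<^sup>2 + 1) = 0"
    using assms by (simp add: algebra_simps power4_eq_xxxx power2_eq_square)
  hence "c\<^sup>2 = 1 \<or> c\<^sup>2 = \<i>\<^sup>2" by (auto simp: eq_neg_iff_add_eq_0)
  thus ?thesis by (metis power2_eq_iff power_one)
qed

text \<open>Each single-qubit factor is a product of generators, and the tensor product is assembled
  one qubit at a time.\<close>

lemma pauli_in_pauli_group: "pauli v \<in> pauli_group"
proof -
  have gen: "on_qubit i pauli_x \<in> pauli_group" "on_qubit i pauli_z \<in> pauli_group" for i :: 'a
    unfolding pauli_group_def by (rule generate.incl, blast)+
  have one: "pauli (single i p) \<in> pauli_group" for i :: 'a and p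
  proof (cases p)
    case (Pair x z)
    have "pauli1 (x, z) = (if x then pauli_x else mat 1) ** (if z then pauli_z else mat 1)"
      by (auto simp: vec_eq_iff pauli_x_def pauli_z_def mat_def matrix_matrix_mult_def UNIV_bool)
    hence "pauli1 p = pauli1 (x, False) ** pauli1 (False, z)"
      unfolding Pair pauli1_mult by simp
    hence "pauli (single i p) = pauli (single i (x, False)) ** pauli (single i (False, z))"
      unfolding pauli_def tensor_mult
      by (intro arg_cong[of _ _ tensor]) (auto simp: fun_eq_iff single_def pauli1_one simp del: pauli1.simps)
    moreover have "pauli (single i (x, False)) \<in> pauli_group"
      using gen(1)[of i] pauli_group_one
      by (cases x) (simp_all add: pauli_single_x, simp add: single_def fun_upd_idem pauli_zero)
    moreover have "pauli (single i (False, z)) \<in> pauli_group"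
      using gen(2)[of i] pauli_group_one
      by (cases z) (simp_all add: pauli_single_z, simp add: single_def fun_upd_idem pauli_zero)
    ultimately show ?thesis by (simp add: pauli_group_mult)
  qed
  have "pauli (\<lambda>k. if k \<in> S then v k else I1) \<in> pauli_group" if "finite S" for S
    using that
  proof induction
    case empty
    thus ?case by (simp add: pauli_zero pauli_group_one)
  next
    case (insert i S)
    have "psign I1 p = 1 \<and> padd I1 p = p \<and> psign p I1 = 1 \<and> padd p I1 = p" for p
      by (cases p) auto
    hence "pauli (\<lambda>k. if k \<in> insert i S then v k else I1)
        = pauli (single i (v i)) ** pauli (\<lambda>k. if k \<in> S then v k else I1)"
      unfolding pauli_def tensor_mult using insert.hyps
      by (intro arg_cong[of _ _ tensor])
        (auto simp: fun_eq_iff single_def pauli1_mult simp del: pauli1.simps)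
    thus ?case using insert.IH one by (simp add: pauli_group_mult)
  qed
  from this[of UNIV] show ?thesis by simp
qed

text \<open>Reordering Pauli factors costs only signs, so products keep this normal form; the
  scalars are the powers of the generator \<open>mat \<i>\<close>.\<close>

lemma pauli_group_eq: "pauli_group = {smul c (pauli v) | c v. c ^ 4 = 1}" (is "_ = ?S")
proof
  have memI: "A \<in> ?S" if "A = smul c (pauli v)" "c ^ 4 = 1" for A :: "'a qmat" and c v
    using that by blast
  have sq: "\<i> ^ 4 = 1" "(- \<i>) ^ 4 = 1" "(1::complex) ^ 4 = 1" by simp_all
  show "pauli_group \<subseteq> ?S"
  proof
    fix A :: "'a qmat" assume "A \<in> pauli_group"
    thus "A \<in> ?S"
      unfolding pauli_group_def
    proof (induction rule: generate.induct)
      case one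
      have "\<one>\<^bsub>unitary_group\<^esub> = smul 1 (pauli (\<lambda>_. I1) :: 'a qmat)"
        by (simp add: pauli_zero)
      from memI[OF this sq(3)] show ?case .
    next
      case (incl A)
      have "mat \<i> = smul \<i> (pauli (\<lambda>_. I1) :: 'a qmat)"
        by (simp add: pauli_zero mat_eq_smul[of \<i>])
      note i = memI[OF this sq(1)]
      have xz: "on_qubit i pauli_x = smul 1 (pauli (single i X1))"
        "on_qubit i pauli_z = smul 1 (pauli (single i Z1))" for i :: 'a
        by (simp_all add: pauli_single_x pauli_single_z)
      show ?case using incl i memI[OF xz(1) sq(3)] memI[OF xz(2) sq(3)] by auto
    next
      case (inv A)
      have "dagger (mat \<i>) = smul (- \<i>) (pauli (\<lambda>_. I1) :: 'a qmat)"
        by (simp add: pauli_zero mat_eq_smul[of "- \<i>"])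
      note i = memI[OF this sq(2)]
      have xz: "dagger (on_qubit i pauli_x) = smul 1 (pauli (single i X1))"
        "dagger (on_qubit i pauli_z) = smul 1 (pauli (single i Z1))" for i :: 'a
        by (auto simp: dagger_def on_qubit_def pauli_x_def pauli_z_def vec_eq_iff
            pauli_single_x pauli_single_z)
      have "dagger A \<in> ?S"
        using inv i memI[OF xz(1) sq(3)] memI[OF xz(2) sq(3)] by (elim UnE imageE) auto
      moreover have "inv\<^bsub>unitary_group\<^esub> A = dagger A"
        using inv pauli_generators_unitary by (intro inv_unitary_group) blast
      ultimately show ?case by (simp only:)
    next
      case (eng A B)
      then obtain c u d v where *: "A = smul c (pauli u)" "B = smul d (pauli v)"
        "c ^ 4 = 1" "d ^ 4 = 1" by blast
      have "A \<otimes>\<^bsub>unitary_group\<^esub> B = smul (c * d * vsign u v) (pauli (vadd u v))"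
        by (simp add: * pauli_mult mult_ac)
      moreover have "(c * d * vsign u v) ^ 4 = 1"
        using vsign_cases[of u v] by (auto simp: power_mult_distrib *(3,4))
      ultimately show ?case by (rule memI)
    qed
  qed
next
  have "smul c (pauli v) \<in> pauli_group" if c: "c ^ 4 = 1" for c and v :: "'a \<Rightarrow> bool \<times> bool"
  proof -
    have i: "smul \<i> A \<in> pauli_group" if "A \<in> pauli_group" for A :: "'a qmat"
      using pauli_group_mult[OF mat_i_in_pauli_group that] by (simp add: mat_eq_smul[of \<i>])
    from i[OF pauli_in_pauli_group] have "smul \<i> (pauli v) \<in> pauli_group" .
    moreover from i[OF this] have "smul (-1) (pauli v) \<in> pauli_group" by simp
    moreover from i[OF this] have "smul (- \<i>) (pauli v) \<in> pauli_group" by simp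
    ultimately show ?thesis
      using fourth_root_of_unity[OF c] pauli_in_pauli_group[of v] by auto
  qed
  thus "?S \<subseteq> pauli_group" by blast
qed

text \<open>Finiteness lets \<open>cliffordI\<close> conclude that an injective conjugation is
  onto.\<close>

lemma finite_pauli_group: "finite (pauli_group :: ('m::finite) qmat set)"
proof (rule finite_subset)
  let ?f = "\<lambda>p. smul (fst p) (pauli (snd p)) :: 'm qmat"
  have "smul c (pauli v) \<in> ?f ` ({c. c ^ 4 = 1} \<times> UNIV)" if "c ^ 4 = 1" for c v
    by (rule image_eqI[of _ _ "(c, v)"]) (simp_all add: that)
  thus "pauli_group \<subseteq> ?f ` ({c. c ^ 4 = 1} \<times> UNIV)"
    unfolding pauli_group_eq by blast
  have "finite {c :: complex. c ^ 4 = 1}"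
    using finite_roots_unity[of 4, where 'a = complex] by simp
  thus "finite (?f ` ({c. c ^ 4 = 1} \<times> UNIV))"
    by (rule finite_imageI[OF finite_cartesian_product[OF _ finite]])
qed

section \<open>Action of operators on Pauli operators up to scalars\<close>

text \<open>For unitary \<open>A\<close> this is conjugation by \<open>A\<close>, with the inverse
  cleared so that such relations compose by plain rewriting. The scalar stays unspecified because
  only the action on bit vectors matters.\<close>

definition maps :: "('m::finite) qmat \<Rightarrow> ('m \<Rightarrow> bool \<times> bool) \<Rightarrow> ('m \<Rightarrow> bool \<times> bool) \<Rightarrow> bool" where
  "maps A u v \<longleftrightarrow> (\<exists>c. c \<noteq> 0 \<and> A ** pauli u = smul c (pauli v ** A))"

lemma mapsI: "A ** pauli u = smul c (pauli v ** A) \<Longrightarrow> c \<noteq> 0 \<Longrightarrow> maps A u v"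
  by (auto simp: maps_def)

lemma unitary_conj_eq_iff:
  assumes "A \<in> carrier unitary_group"
  shows "A ** P ** dagger A = Q \<longleftrightarrow> A ** P = Q ** A"
  using assms by (metis matrix_mul_assoc matrix_mul_rid unitary_group_simps(1))

text \<open>Conjugation is injective, and the Pauli group is finite, so mapping the group into
  itself already means normalising it.\<close>

lemma cliffordI:
  fixes A :: "('m::finite) qmat"
  assumes A: "A \<in> carrier unitary_group"
    and conj: "\<And>u. \<exists>v c. c ^ 4 = 1 \<and> A ** pauli u = smul c (pauli v ** A)"
  shows "A \<in> carrier clifford_group"
proof -
  let ?f = "\<lambda>P. A ** P ** dagger A"
  have closed: "?f P \<in> pauli_group" if "P \<in> pauli_group" for P
  proof -
    obtain c u where P: "P = smul c (pauli u)" and c: "c ^ 4 = 1"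
      using \<open>P \<in> pauli_group\<close> unfolding pauli_group_eq by blast
    obtain d v where d: "d ^ 4 = 1" and eq: "A ** pauli u = smul d (pauli v ** A)"
      using conj by blast
    have "?f P = smul (c * d) (pauli v)"
      unfolding unitary_conj_eq_iff[OF A] by (simp add: P eq)
    moreover have "(c * d) ^ 4 = 1" by (simp add: power_mult_distrib c d)
    ultimately show ?thesis unfolding pauli_group_eq by blast
  qed
  have inj: "inj_on ?f pauli_group"
  proof (rule inj_onI)
    fix P Q assume "?f P = ?f Q"
    hence "dagger A ** (?f P) ** A = dagger A ** (?f Q) ** A" by simp
    moreover have "dagger A ** (?f R) ** A = R" for R
    proof -
      have "dagger A ** (?f R) ** A = (dagger A ** A) ** R ** (dagger A ** A)"
        by (simp only: matrix_mul_assoc)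
      thus ?thesis using A by simp
    qed
    ultimately show "P = Q" by simp
  qed
  have "?f ` pauli_group = pauli_group"
    by (rule endo_inj_surj[OF finite_pauli_group image_subsetI[OF closed] inj])
  thus ?thesis by (rule mem_clifford_group_iff[THEN iffD2, OF conjI[OF A]])
qed

lemma clifford_unitary: "A \<in> carrier clifford_group \<Longrightarrow> A \<in> carrier unitary_group"
  by (rule mem_clifford_group_iff[THEN iffD1, THEN conjunct1])

lemma clifford_maps:
  assumes "A \<in> carrier clifford_group"
  obtains v where "maps A u v"
proof -
  have "(\<lambda>P. A ** P ** dagger A) ` pauli_group = pauli_group"
    by (rule mem_clifford_group_iff[THEN iffD1, THEN conjunct2, OF assms])
  hence "A ** pauli u ** dagger A \<in> pauli_group"
    using pauli_in_pauli_group[of u] by blast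
  then obtain c v where c: "c ^ 4 = 1" and "A ** pauli u ** dagger A = smul c (pauli v)"
    unfolding pauli_group_eq by blast
  hence "A ** pauli u = smul c (pauli v ** A)"
    using unitary_conj_eq_iff[OF clifford_unitary[OF assms]] by simp
  moreover have "c \<noteq> 0" using c by auto
  ultimately have "maps A u v" by (rule mapsI)
  thus ?thesis by (rule that)
qed

lemma maps_comp:
  assumes "maps A u v" "maps B v w"
  shows "maps (B ** A) u w"
proof -
  obtain c d where c: "c \<noteq> 0" "A ** pauli u = smul c (pauli v ** A)"
    and d: "d \<noteq> 0" "B ** pauli v = smul d (pauli w ** B)"
    using assms by (auto simp: maps_def)
  have "B ** A ** pauli u = smul c (B ** pauli v ** A)"
    by (simp add: c(2) flip: matrix_mul_assoc)
  also have "\<dots> = smul (c * d) (pauli w ** (B ** A))"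
    by (simp add: d(2)) (simp flip: matrix_mul_assoc)
  finally show ?thesis by (rule mapsI) (use c d in simp)
qed

lemma unitary_nonzero:
  fixes A :: "complex ^ 'n ^ 'n"
  assumes "A \<in> carrier unitary_group"
  shows "A \<noteq> 0"
proof
  assume "A = 0"
  hence "(mat 1 :: complex ^ 'n ^ 'n) = 0"
    using assms by simp
  hence "(mat 1 :: complex ^ 'n ^ 'n) $ a $ a = 0" for a by simp
  thus False by (simp add: mat_def)
qed

text \<open>The induced action on bit vectors is symplectic: moving \<open>A\<close> past two Pauli
  operators in either order produces the same scalars, so the sign of the swap must agree on both
  sides.\<close>

lemma maps_comm:
  assumes A: "A \<in> carrier unitary_group" and "maps A u v" "maps A u' v'"
  shows "comm u u' = comm v v'"
proof -
  obtain c d where c: "c \<noteq> 0" "A ** pauli u = smul c (pauli v ** A)"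
    and d: "d \<noteq> 0" "A ** pauli u' = smul d (pauli v' ** A)"
    using assms by (auto simp: maps_def)
  have 1: "A ** (pauli u ** pauli u') = smul (c * d) (pauli v ** pauli v' ** A)"
    by (simp add: matrix_mul_assoc c(2), simp add: d(2) flip: matrix_mul_assoc)
  have 2: "A ** (pauli u' ** pauli u) = smul (c * d) (pauli v' ** pauli v ** A)"
    by (simp add: matrix_mul_assoc d(2), simp add: c(2) mult.commute flip: matrix_mul_assoc)
  have "smul (c * d * comm v v') (pauli v' ** pauli v ** A) = A ** (pauli u ** pauli u')"
    by (simp add: 1 pauli_commute[of v v'])
  also have "\<dots> = smul (c * d * comm u u') (pauli v' ** pauli v ** A)"
    by (simp add: 2 pauli_commute[of u u'] mult_ac)
  finally have "c * d * comm v v' = c * d * comm u u'"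
    using unitary_nonzero[OF unitary_mult[OF unitary_mult[OF pauli_unitary pauli_unitary] A]]
    by (rule smul_left_eqD)
  thus ?thesis using c d by simp
qed

section \<open>The available gates\<close>

lemma pauli_clifford: "pauli v \<in> carrier clifford_group"
proof (rule cliffordI[OF pauli_unitary])
  fix u
  have "comm v u ^ 4 = 1" using comm_cases[of v u] by auto
  thus "\<exists>w c. c ^ 4 = 1 \<and> pauli v ** pauli u = smul c (pauli w ** pauli v)"
    using pauli_commute by blast
qed

lemma clifford_mult:
  "A \<in> carrier clifford_group \<Longrightarrow> B \<in> carrier clifford_group \<Longrightarrow> A ** B \<in> carrier clifford_group"
  using subgroup.m_closed[OF subgroup_clifford] by (simp add: clifford_group_def)

lemma clifford_inv: "A \<in> carrier clifford_group \<Longrightarrow> inv\<^bsub>clifford_group\<^esub> A = dagger A"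
  using group.m_inv_consistent[OF group_unitary_group subgroup_clifford, of A] clifford_unitary[of A]
  by (simp add: clifford_group_def inv_unitary_group)

lemma clifford_dagger: "A \<in> carrier clifford_group \<Longrightarrow> dagger A \<in> carrier clifford_group"
  using group.inv_closed[OF group_clifford_group, of A] by (simp only: clifford_inv)

lemma hadamard_unitary: "hadamard \<in> carrier unitary_group"
proof -
  have "dagger hadamard = hadamard"
    by (auto simp: hadamard_def dagger_def vec_eq_iff)
  moreover have "hadamard ** hadamard = mat 1"
    by (auto simp: hadamard_def matrix_matrix_mult_def vec_eq_iff mat_def UNIV_bool simp flip: of_real_mult)
  ultimately show ?thesis by simp
qed

text \<open>The Hadamard gate exchanges X and Z, and the sign restores the order X before Z.\<close>

lemma hadamard_pauli1: "hadamard ** pauli1 p = smul (psign p p) (pauli1 (prod.swap p) ** hadamard)"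
  by (cases p) (auto simp: hadamard_def matrix_matrix_mult_def vec_eq_iff UNIV_bool)

lemma hadamard_all_unitary: "on_all_qubits hadamard \<in> carrier unitary_group"
  unfolding on_all_qubits_eq_tensor using hadamard_unitary by (rule tensor_unitary)

lemma hadamard_all_pauli:
  "on_all_qubits hadamard ** pauli u = smul (vsign u u) (pauli (\<lambda>k. prod.swap (u k)) ** on_all_qubits hadamard)"
  by (simp add: on_all_qubits_eq_tensor pauli_def tensor_mult hadamard_pauli1 tensor_smul vsign_def)

lemma hadamard_all_clifford: "on_all_qubits hadamard \<in> carrier clifford_group"
proof (rule cliffordI[OF hadamard_all_unitary])
  fix u :: "'a \<Rightarrow> bool \<times> bool"
  have "vsign u u ^ 4 = 1" using vsign_cases[of u u] by auto
  thus "\<exists>v c. c ^ 4 = 1 \<and> on_all_qubits hadamard ** pauli u = smul c (pauli v ** on_all_qubits hadamard)"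
    using hadamard_all_pauli by blast
qed

lemma phase_s_clifford: "on_qubit i phase_s \<in> carrier clifford_group"
proof (rule cliffordI)
  have "phase_s \<in> carrier unitary_group"
    by (auto simp: phase_s_def dagger_def vec_eq_iff matrix_matrix_mult_def UNIV_bool mat_def)
  moreover have "mat 1 \<in> carrier (unitary_group :: qubit_mat monoid)" by simp
  ultimately show "on_qubit i phase_s \<in> carrier unitary_group"
    unfolding on_qubit_eq_tensor by (intro tensor_unitary) (metis (full_types))
  fix u :: "'a \<Rightarrow> bool \<times> bool"
  define c where "c = (\<lambda>k. if k = i \<and> fst (u k) then \<i> else 1)"
  define v where "v = (\<lambda>k. if k = i \<and> fst (u k) then (True, \<not> snd (u k)) else u k)"
  \<comment> \<open>Conjugation by the phase gate fixes Z and sends X to \<open>\<i> X Z\<close>: a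
    set X bit toggles the Z bit.\<close>
  have "phase_s ** pauli1 p
      = smul (if fst p then \<i> else 1) (pauli1 (if fst p then (True, \<not> snd p) else p) ** phase_s)" for p
    by (cases p) (auto simp: phase_s_def vec_eq_iff matrix_matrix_mult_def UNIV_bool)
  hence "(if k = i then phase_s else mat 1) ** pauli1 (u k)
      = smul (c k) (pauli1 (v k) ** (if k = i then phase_s else mat 1))" for k
    by (simp add: c_def v_def)
  hence "on_qubit i phase_s ** pauli u = smul (\<Prod>k\<in>UNIV. c k) (pauli v ** on_qubit i phase_s)"
    by (simp add: on_qubit_eq_tensor pauli_def tensor_mult tensor_smul)
  moreover have "(\<Prod>k\<in>UNIV. c k) ^ 4 = 1"
    unfolding prod_power_distrib c_def by (rule prod.neutral) simp
  ultimately show "\<exists>v c. c ^ 4 = 1 \<and> on_qubit i phase_s ** pauli u = smul c (pauli v ** on_qubit i phase_s)"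
    by blast
qed

lemma sum_single_term:
  fixes f :: "'a::finite \<Rightarrow> complex"
  assumes "\<And>c. c \<noteq> x \<Longrightarrow> f c = 0"
  shows "(\<Sum>c\<in>UNIV. f c) = f x"
  using assms by (subst sum.mono_neutral_right[of _ "{x}"]) auto

definition cnot_bits :: "'m \<Rightarrow> 'm \<Rightarrow> ('m \<Rightarrow> bool) \<Rightarrow> 'm \<Rightarrow> bool" where
  "cnot_bits i j b = b(j := (b j \<noteq> b i))"

lemma cnot_bits_self_inverse [simp]: "i \<noteq> j \<Longrightarrow> cnot_bits i j (cnot_bits i j b) = b"
  by (auto simp: cnot_bits_def fun_eq_iff)

lemma cnot_bits_eq_iff: "i \<noteq> j \<Longrightarrow> a = cnot_bits i j b \<longleftrightarrow> b = cnot_bits i j a"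
  by (metis cnot_bits_self_inverse)

lemma cnot_nth: "cnot i j $ a $ b = (if a = cnot_bits i j b then 1 else 0)"
  by (simp add: cnot_def cnot_bits_def)

lemma mult_cnot_nth: "(A ** cnot i j) $ a $ b = A $ a $ (cnot_bits i j b)"
  unfolding matrix_matrix_mult_def
  by simp (subst sum_single_term[of "cnot_bits i j b"], auto simp: cnot_nth)

lemma cnot_mult_nth:
  assumes "i \<noteq> j"
  shows "(cnot i j ** A) $ a $ b = A $ (cnot_bits i j a) $ b"
  unfolding matrix_matrix_mult_def
  by simp (subst sum_single_term[of "cnot_bits i j a"],
      auto simp: cnot_nth cnot_bits_eq_iff[OF assms, of a])

lemma dagger_cnot: "i \<noteq> j \<Longrightarrow> dagger (cnot i j) = cnot i j"
  using cnot_bits_eq_iff[of i j] by (simp add: dagger_def vec_eq_iff cnot_nth)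

lemma cnot_square: "i \<noteq> j \<Longrightarrow> cnot i j ** cnot i j = mat 1"
  by (simp add: vec_eq_iff mult_cnot_nth cnot_nth mat_def)

lemma cnot_unitary: "i \<noteq> j \<Longrightarrow> cnot i j \<in> carrier unitary_group"
  by (simp add: dagger_cnot cnot_square)

text \<open>X spreads from the control to the target, Z from the target back to the control.\<close>

definition cnot_pauli :: "'m \<Rightarrow> 'm \<Rightarrow> ('m \<Rightarrow> bool \<times> bool) \<Rightarrow> 'm \<Rightarrow> bool \<times> bool" where
  "cnot_pauli i j u = u(i := (fst (u i), snd (u i) \<noteq> snd (u j)), j := (fst (u j) \<noteq> fst (u i), snd (u j)))"

text \<open>Entries at the control (\<open>a\<close>, \<open>b\<close>) and the target
  (\<open>a'\<close>, \<open>b'\<close>). The sign that \<open>z'\<close> adds to the first factor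
  on the right cancels the one from replacing \<open>b'\<close> by its sum with \<open>b\<close>, so
  no net sign appears.\<close>

lemma cnot_pauli1:
  "pauli1 (x, z) $ a $ b * pauli1 (x', z') $ (a' \<noteq> a) $ b'
    = pauli1 (x, z \<noteq> z') $ a $ b * pauli1 (x' \<noteq> x, z') $ a' $ (b' \<noteq> b)"
  by (cases a; cases b; cases a'; cases b'; cases x; simp)

lemma cnot_mult_pauli:
  assumes "i \<noteq> j"
  shows "cnot i j ** pauli u = pauli (cnot_pauli i j u) ** cnot i j"
proof -
  let ?v = "cnot_pauli i j u"
  have "pauli u $ (cnot_bits i j a) $ b = pauli ?v $ a $ (cnot_bits i j b)" for a b
  proof -
    \<comment> \<open>Only the factors at \<open>i\<close> and \<open>j\<close> change, so they are
      separated from the rest.\<close>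
    have split: "(\<Prod>k\<in>UNIV. f k) = f i * f j * (\<Prod>k\<in>UNIV - {i, j}. f k)" for f :: "'a \<Rightarrow> complex"
    proof -
      have "(\<Prod>k\<in>UNIV. f k) = f i * (\<Prod>k\<in>UNIV - {i}. f k)"
        by (rule prod.remove) auto
      also have "(\<Prod>k\<in>UNIV - {i}. f k) = f j * (\<Prod>k\<in>UNIV - {i} - {j}. f k)"
        using assms by (intro prod.remove) auto
      also have "UNIV - {i} - {j} = UNIV - {i, j}" by auto
      finally show ?thesis by (simp only: mult.assoc)
    qed
    have 1: "pauli1 (u i) $ a i $ b i * pauli1 (u j) $ (a j \<noteq> a i) $ b j
        = pauli1 (?v i) $ a i $ b i * pauli1 (?v j) $ a j $ (b j \<noteq> b i)"
      using assms cnot_pauli1[of "fst (u i)" "snd (u i)" "a i" "b i" "fst (u j)" "snd (u j)" "a j" "b j"]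
      by (simp add: cnot_pauli_def del: pauli1.simps)
    have 2: "(\<Prod>k\<in>UNIV - {i, j}. pauli1 (u k) $ cnot_bits i j a k $ b k)
        = (\<Prod>k\<in>UNIV - {i, j}. pauli1 (?v k) $ a k $ cnot_bits i j b k)"
      by (intro prod.cong) (auto simp: cnot_bits_def cnot_pauli_def)
    show ?thesis
      unfolding pauli_def tensor_def
      using 1 2 assms by (simp add: split cnot_bits_def del: pauli1.simps)
  qed
  thus ?thesis by (simp add: vec_eq_iff cnot_mult_nth[OF assms] mult_cnot_nth)
qed

lemma cnot_clifford:
  assumes "i \<noteq> j"
  shows "cnot i j \<in> carrier clifford_group"
proof (rule cliffordI[OF cnot_unitary[OF assms]])
  fix u
  have "(1::complex) ^ 4 = 1" "cnot i j ** pauli u = smul 1 (pauli (cnot_pauli i j u) ** cnot i j)"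
    by (simp_all add: cnot_mult_pauli[OF assms])
  thus "\<exists>v c. c ^ 4 = 1 \<and> cnot i j ** pauli u = smul c (pauli v ** cnot i j)"
    by blast
qed

lemma available_gates_clifford: "available_gates \<subseteq> carrier clifford_group"
  unfolding available_gates_def
  by (auto simp: pauli_clifford hadamard_all_clifford clifford_mult clifford_dagger
      phase_s_clifford cnot_clifford simp flip: pauli_single_x pauli_single_z)

section \<open>Operators generated by the gates up to phase\<close>

text \<open>The preimage of the subgroup that the gates generate modulo phases; working here avoids
  cosets until the final theorem.\<close>

definition gate_span :: "('m::finite) qmat set" where
  "gate_span = {smul (cis t) B | t B. B \<in> generate clifford_group available_gates}"

lemma generate_clifford: "generate clifford_group available_gates \<subseteq> carrier clifford_group"
  by (rule group.generate_incl[OF group_clifford_group available_gates_clifford])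

lemma gate_spanI: "B \<in> generate clifford_group available_gates \<Longrightarrow> smul (cis t) B \<in> gate_span"
  by (auto simp: gate_span_def)

lemma gate_span_mult:
  assumes "A \<in> gate_span" "B \<in> gate_span"
  shows "A ** B \<in> gate_span"
proof -
  obtain s t A' B' where *: "A = smul (cis s) A'" "B = smul (cis t) B'"
    "A' \<in> generate clifford_group available_gates" "B' \<in> generate clifford_group available_gates"
    using assms by (auto simp: gate_span_def)
  have "A' \<otimes>\<^bsub>clifford_group\<^esub> B' = A' ** B'" by (simp add: clifford_group_def)
  hence "A' ** B' \<in> generate clifford_group available_gates"
    using generate.eng[OF *(3,4)] by simp
  from gate_spanI[OF this, of "s + t"] show ?thesis
    by (simp add: * cis_mult add.commute)
qed

lemma gate_span_dagger:
  assumes "A \<in> gate_span"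
  shows "dagger A \<in> gate_span"
proof -
  obtain t A' where *: "A = smul (cis t) A'" "A' \<in> generate clifford_group available_gates"
    using assms by (auto simp: gate_span_def)
  have "inv\<^bsub>clifford_group\<^esub> A' \<in> generate clifford_group available_gates"
    by (rule group.generate_m_inv_closed[OF group_clifford_group available_gates_clifford *(2)])
  hence "dagger A' \<in> generate clifford_group available_gates"
    using *(2) generate_clifford by (subst (asm) clifford_inv) blast+
  from gate_spanI[OF this, of "- t"] show ?thesis by (simp add: * cis_cnj)
qed

lemma gate_span_smul:
  assumes "A \<in> gate_span"
  shows "smul (cis t) A \<in> gate_span"
proof -
  obtain s A' where *: "A = smul (cis s) A'" "A' \<in> generate clifford_group available_gates"
    using assms by (auto simp: gate_span_def)
  from gate_spanI[OF *(2), of "t + s"] show ?thesis by (simp add: * cis_mult)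
qed

lemma gate_span_smul_iff: "smul (cis t) A \<in> gate_span \<longleftrightarrow> A \<in> gate_span"
  using gate_span_smul[of A t] gate_span_smul[of "smul (cis t) A" "- t"] by (auto simp: cis_mult)

lemma gate_span_smul_norm_iff:
  assumes "cmod c = 1"
  shows "smul c A \<in> gate_span \<longleftrightarrow> A \<in> gate_span"
proof -
  have "c \<noteq> 0" using assms by auto
  hence "cis (Arg c) = c" using assms by (simp add: cis_Arg sgn_div_norm)
  thus ?thesis using gate_span_smul_iff[of "Arg c" A] by simp
qed

lemma gate_span_gate: "A \<in> available_gates \<Longrightarrow> A \<in> gate_span"
  using gate_spanI[OF generate.incl[of A available_gates clifford_group], of 0] by simp

lemma gate_span_one: "mat 1 \<in> gate_span"
  using gate_spanI[OF generate.one, of 0] by (simp add: clifford_group_def)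

lemma gate_span_unitary:
  assumes "A \<in> gate_span"
  shows "A \<in> carrier unitary_group"
proof -
  obtain t A' where *: "A = smul (cis t) A'" "A' \<in> generate clifford_group available_gates"
    using assms by (auto simp: gate_span_def)
  hence "A' \<in> carrier unitary_group"
    using generate_clifford clifford_unitary by blast
  thus ?thesis unfolding *(1) by (rule smul_cis_unitary)
qed

section \<open>Diagonal operators and the single phase gate\<close>

lemma matrix_add_mult: "(A + B) ** C = A ** C + B ** (C :: complex ^ 'n ^ 'n)"
  by (simp add: matrix_matrix_mult_def vec_eq_iff distrib_right sum.distrib)

definition diag_mat :: "('a \<Rightarrow> complex) \<Rightarrow> complex ^ 'a ^ 'a" where
  "diag_mat f = (\<chi> a b. if a = b then f a else 0)"

lemma diag_mat_mult: "diag_mat f ** diag_mat g = diag_mat (\<lambda>a. f a * g a)"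
  for f :: "'a::finite \<Rightarrow> complex"
proof -
  have "(\<Sum>c\<in>UNIV. diag_mat f $ a $ c * diag_mat g $ c $ b) = diag_mat f $ a $ a * diag_mat g $ a $ b" for a b
    by (rule sum_single_term) (simp add: diag_mat_def)
  thus ?thesis by (simp add: vec_eq_iff matrix_matrix_mult_def) (simp add: diag_mat_def)
qed

lemma dagger_diag_mat: "dagger (diag_mat f) = diag_mat (\<lambda>a. cnj (f a))"
  by (auto simp: vec_eq_iff diag_mat_def dagger_def)

lemma cnot_conj_diag_mat:
  assumes "i \<noteq> j"
  shows "cnot i j ** diag_mat f ** cnot i j = diag_mat (\<lambda>a. f (cnot_bits i j a))"
proof -
  have "cnot_bits i j a = cnot_bits i j b \<longleftrightarrow> a = b" for a b
    using cnot_bits_self_inverse[OF assms] by metis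
  thus ?thesis
    by (simp add: vec_eq_iff cnot_mult_nth[OF assms] mult_cnot_nth diag_mat_def)
qed

definition phi :: "bool \<Rightarrow> complex" where
  "phi b = (if b then \<i> else 1)"

lemma phase_s_eq_diag_mat: "on_qubit i phase_s = diag_mat (\<lambda>a. phi (a i))"
  by (auto simp: vec_eq_iff diag_mat_def on_qubit_def phase_s_def phi_def fun_eq_iff)

text \<open>
  The seven nonzero linear forms in three bits take the value 1 either four times or never, so the
  product of the corresponding phase gates is the identity. Dividing each factor by \<open>S\<^sub>i\<close>
  yields \<open>S\<^sub>i\<^sup>-\<^sup>7 = S\<^sub>i\<close> as a product of CNOT conjugates of the paired gates.
\<close>

lemma phase_s_in_gate_span:
  assumes "CARD('m::finite) \<ge> 3"
  shows "on_qubit (i::'m) phase_s \<in> gate_span"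
proof -
  \<comment> \<open>The argument uses linear forms in three bits, hence two qubits besides
    \<open>i\<close>.\<close>
  have "\<exists>j. j \<noteq> i \<and> (\<exists>k. k \<noteq> i \<and> k \<noteq> j)"
  proof (rule ccontr)
    assume *: "\<not> ?thesis"
    have "\<exists>j. UNIV \<subseteq> {i, j}" using * by (metis (full_types) insert_iff subsetI)
    then obtain j where "UNIV \<subseteq> {i, j}" ..
    from card_mono[OF _ this] have "CARD('m) \<le> 2" by (simp add: card_insert_if split: if_splits)
    thus False using assms by simp
  qed
  then obtain j k where jk: "j \<noteq> i" "k \<noteq> i" "k \<noteq> j" by blast
  have gate: "diag_mat (\<lambda>a. phi (a l) * cnj (phi (a i))) \<in> gate_span" if "l \<noteq> i" for l :: 'm
  proof -
    have "diag_mat (\<lambda>a. phi (a l) * cnj (phi (a i))) = on_qubit l phase_s ** dagger (on_qubit i phase_s)"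
      by (simp add: phase_s_eq_diag_mat dagger_diag_mat diag_mat_mult)
    also have "\<dots> \<in> available_gates"
      using that unfolding available_gates_def by blast
    finally show ?thesis by (rule gate_span_gate)
  qed
  \<comment> \<open>Conjugation by a CNOT substitutes its linear map into the exponent of a diagonal
    gate.\<close>
  have conj: "diag_mat (\<lambda>a. f (cnot_bits p q a)) \<in> gate_span"
    if "diag_mat f \<in> gate_span" "p \<noteq> q" for f and p q :: 'm
  proof -
    have "cnot p q \<in> gate_span"
      using that(2) by (intro gate_span_gate) (auto simp: available_gates_def)
    with that show ?thesis
      by (subst cnot_conj_diag_mat[symmetric]) (auto intro: gate_span_mult)
  qed
  \<comment> \<open>A phase gate on the linear form \<open>l\<close>, divided by the one on qubit
    \<open>i\<close>. The facts below cover the six nonzero forms in three bits other than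
    \<open>a i\<close>.\<close>
  let ?D = "\<lambda>l. diag_mat (\<lambda>a. phi (l a) * cnj (phi (a i))) :: 'm qmat"
  have 1: "?D (\<lambda>a. a j) \<in> gate_span" and 2: "?D (\<lambda>a. a k) \<in> gate_span"
    using gate jk by auto
  \<comment> \<open>In all these conjugations the target differs from \<open>i\<close>, so the
    divisor is unchanged.\<close>
  have 3: "?D (\<lambda>a. a j \<noteq> a k) \<in> gate_span"
    using conj[OF 1, of k j] jk by (simp add: cnot_bits_def)
  have 4: "?D (\<lambda>a. a j \<noteq> a i) \<in> gate_span"
    using conj[OF 1, of i j] jk by (simp add: cnot_bits_def)
  have 5: "?D (\<lambda>a. a k \<noteq> a i) \<in> gate_span"
    using conj[OF 2, of i k] jk by (simp add: cnot_bits_def)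
  have 6: "?D (\<lambda>a. (a j \<noteq> a i) \<noteq> a k) \<in> gate_span"
    using conj[OF 3, of i j] jk by (simp add: cnot_bits_def)
  have "?D (\<lambda>a. a j) ** ?D (\<lambda>a. a k) ** ?D (\<lambda>a. a j \<noteq> a k) ** ?D (\<lambda>a. a j \<noteq> a i)
      ** ?D (\<lambda>a. a k \<noteq> a i) ** ?D (\<lambda>a. (a j \<noteq> a i) \<noteq> a k) = on_qubit i phase_s"
    unfolding phase_s_eq_diag_mat diag_mat_mult
    by (intro arg_cong[of _ _ diag_mat] ext) (auto simp: phi_def)
  thus ?thesis
    by (rule subst) (intro gate_span_mult 1 2 3 4 5 6)
qed

section \<open>Transvections\<close>

text \<open>If \<open>M = c * pauli v\<close> squares to -1, this is the exponential of
  \<open>(pi/4) M\<close>.\<close>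

definition rot :: "complex \<Rightarrow> ('m::finite \<Rightarrow> bool \<times> bool) \<Rightarrow> 'm qmat" where
  "rot c v = smul (1 / sqrt 2) (mat 1 + smul c (pauli v))"

text \<open>
  The condition on \<open>c\<close> says that \<open>c W\<close> squares to \<open>-1\<close>, where \<open>W\<close> is the Pauli operator of \<open>v\<close>.
\<close>

definition rot_in_span :: "('m::finite \<Rightarrow> bool \<times> bool) \<Rightarrow> bool" where
  "rot_in_span v \<longleftrightarrow> (\<exists>c. c\<^sup>2 * vsign v v = -1 \<and> rot c v \<in> gate_span)"

lemma sqrt2_mult_sqrt2: "complex_of_real (sqrt 2) * complex_of_real (sqrt 2) = 2"
  by (simp flip: of_real_mult)

lemma rot_scalar_cmod:
  assumes "c\<^sup>2 * vsign v v = -1"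
  shows "cmod c = 1"
proof -
  have "cmod (c\<^sup>2 * vsign v v) = 1" using assms by simp
  moreover have "cmod (vsign v v) = 1" using vsign_cases[of v v] by auto
  ultimately have "(cmod c)\<^sup>2 = 1" by (simp add: norm_mult norm_power)
  thus ?thesis by (simp add: power2_eq_1_iff) (use norm_ge_zero[of c] in linarith)
qed

lemma rot_commute:
  assumes "comm v u = 1"
  shows "rot c v ** pauli u = pauli u ** rot c v"
  using pauli_commute[of v u] assms
  by (simp add: rot_def matrix_add_ldistrib matrix_add_mult)

text \<open>With \<open>M = c P\<close>, \<open>M^2 = -1\<close> and \<open>Q\<close> anticommuting
  with \<open>P\<close>: \<open>(1 + M) Q = Q (1 - M) = -Q M (1 + M)\<close>.\<close>

lemma rot_anticommute:
  assumes "comm u v = -1" and c: "c\<^sup>2 * vsign v v = -1"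
  shows "rot c v ** pauli u = smul (- c * vsign u v) (pauli (vadd u v) ** rot c v)"
proof -
  have "smul (- c * vsign u v) (pauli (vadd u v) ** rot c v)
      = smul (- c) (pauli u ** pauli v ** rot c v)"
    by (simp add: pauli_mult)
  also have "\<dots> = smul (1 / sqrt 2) (pauli u ** (smul (- c) (pauli v) + smul (- (c\<^sup>2 * vsign v v)) (mat 1)))"
    by (simp add: rot_def matrix_add_ldistrib smul_add pauli_square power2_eq_square mult_ac
        flip: matrix_mul_assoc)
  also have "\<dots> = smul (1 / sqrt 2) (pauli u + smul (- c) (pauli u ** pauli v))"
    by (simp add: c matrix_add_ldistrib add.commute)
  also have "\<dots> = smul (1 / sqrt 2) (pauli u + smul c (pauli v ** pauli u))"
    using assms(1) by (simp add: pauli_commute[of u v])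
  also have "\<dots> = rot c v ** pauli u"
    by (simp add: rot_def matrix_add_mult)
  finally show ?thesis ..
qed

text \<open>With \<open>M^2 = -1\<close>, the square \<open>(1 + M)^2 / 2\<close> equals
  \<open>M\<close>; this is how Pauli operators are recovered from rotations.\<close>

lemma rot_square:
  assumes c: "c\<^sup>2 * vsign v v = -1"
  shows "rot c v ** rot c v = smul c (pauli v)"
proof -
  have "rot c v ** rot c v = smul (1 / 2) (mat 1 + smul c (pauli v) + (smul c (pauli v) + smul (c\<^sup>2 * vsign v v) (mat 1)))"
    by (simp add: rot_def matrix_add_ldistrib matrix_add_mult smul_add pauli_square
        power2_eq_square sqrt2_mult_sqrt2 add_ac mult_ac) (simp add: vec_eq_iff)
  also have "\<dots> = smul c (pauli v)"
    unfolding c by (simp add: vec_eq_iff)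
  finally show ?thesis .
qed

text \<open>Conjugating a rotation by a generated operator gives the rotation of the image vector,
  with the scalar of \<open>maps\<close> absorbed into \<open>c\<close>.\<close>

lemma rot_in_span_maps:
  assumes B: "B \<in> gate_span" and "maps B u v" and u: "rot_in_span u"
  shows "rot_in_span v"
proof -
  note U = gate_span_unitary[OF B]
  obtain c where c: "c\<^sup>2 * vsign u u = -1" "rot c u \<in> gate_span"
    using u by (auto simp: rot_in_span_def)
  obtain d where d: "B ** pauli u = smul d (pauli v ** B)"
    using assms(2) by (auto simp: maps_def)
  \<comment> \<open>Moving \<open>B\<close> past the square of the Pauli operator determines
    \<open>d * d\<close>, which shows that \<open>c * d\<close> is an admissible scalar for
    \<open>v\<close>.\<close>
  have "smul (vsign u u) B = B ** pauli u ** pauli u"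
    by (simp add: pauli_square flip: matrix_mul_assoc)
  also have "\<dots> = smul (d * d) (pauli v ** (pauli v ** B))"
    by (simp add: d) (simp add: d flip: matrix_mul_assoc)
  also have "\<dots> = smul (d * d * vsign v v) B"
    by (simp add: pauli_square matrix_mul_assoc)
  finally have "vsign u u = d * d * vsign v v"
    by (rule smul_left_eqD[OF _ unitary_nonzero[OF U]])
  hence "(c * d)\<^sup>2 * vsign v v = -1"
    using c(1) by (simp add: power2_eq_square mult_ac)
  moreover have "B ** rot c u = rot (c * d) v ** B"
    by (simp add: rot_def matrix_add_ldistrib matrix_add_mult d)
  hence "B ** rot c u ** dagger B = rot (c * d) v"
    by (rule unitary_conj_eq_iff[OF U, THEN iffD2])
  moreover have "B ** rot c u ** dagger B \<in> gate_span"
    using B c(2) by (intro gate_span_mult gate_span_dagger)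
  ultimately show ?thesis
    unfolding rot_in_span_def by metis
qed

text \<open>On bit vectors the rotation acts as the transvection along \<open>v\<close>: it adds
  \<open>v\<close> to what anticommutes with \<open>v\<close> and fixes what commutes with
  it.\<close>

lemma rot_maps:
  assumes "rot_in_span v" "comm u v = -1"
  shows "\<exists>B\<in>gate_span. maps B u (vadd u v) \<and> (\<forall>t. comm t v = 1 \<longrightarrow> maps B t t)"
proof -
  obtain c where c: "c\<^sup>2 * vsign v v = -1" "rot c v \<in> gate_span"
    using assms by (auto simp: rot_in_span_def)
  have "- c * vsign u v \<noteq> 0" using c(1) vsign_cases[of u v] by auto
  with rot_anticommute[OF assms(2) c(1)] have "maps (rot c v) u (vadd u v)"
    by (rule mapsI)
  moreover have "maps (rot c v) t t" if "comm t v = 1" for t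
    using rot_commute[of v t c] that by (intro mapsI[where c = 1]) (auto simp: comm_commute)
  ultimately show ?thesis using c(2) by blast
qed

lemma rot_in_span_add:
  assumes "rot_in_span u" "rot_in_span v" "comm u v = -1"
  shows "rot_in_span (vadd u v)"
  using rot_maps[OF assms(2,3)] rot_in_span_maps assms(1) by blast

lemma pauli_in_gate_span:
  assumes "rot_in_span v"
  shows "pauli v \<in> gate_span"
proof -
  obtain c where c: "c\<^sup>2 * vsign v v = -1" "rot c v \<in> gate_span"
    using assms by (auto simp: rot_in_span_def)
  have "smul c (pauli v) \<in> gate_span"
    using gate_span_mult[OF c(2) c(2)] by (simp only: rot_square[OF c(1)])
  thus ?thesis by (simp only: gate_span_smul_norm_iff[OF rot_scalar_cmod[OF c(1)]])
qed

lemma vsign_single_xz: "p = X1 \<or> p = Z1 \<Longrightarrow> vsign (single i p) (single i p) = 1"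
  unfolding vsign_def by (intro prod.neutral) (auto simp: single_def)

text \<open>This rotation is a mere phase; the case allows \<open>rot_in_span_all\<close> to be
  stated for every vector.\<close>

lemma rot_in_span_zero: "rot_in_span (\<lambda>_. I1)"
proof -
  have "\<i>\<^sup>2 * vsign (\<lambda>_::'a. I1) (\<lambda>_. I1) = -1"
    by (simp add: vsign_def)
  moreover have "rot \<i> (\<lambda>_. I1) = smul ((1 + \<i>) / sqrt 2) (mat 1 :: 'a qmat)"
    by (simp add: rot_def pauli_zero vec_eq_iff mat_def field_simps)
  moreover have "cmod ((1 + \<i>) / sqrt 2) = 1"
    by (simp add: norm_divide cmod_def power_divide)
  ultimately show ?thesis
    unfolding rot_in_span_def using gate_span_one by (metis gate_span_smul_norm_iff)
qed

section \<open>Rotations along all vectors, for at least three qubits\<close>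

context
  assumes card: "CARD('m::finite) \<ge> 3"
begin

text \<open>Since \<open>(1 + \<i>) / (1 - \<i>) = \<i>\<close>, the operator
  \<open>1 - \<i> Z\<close> is a multiple of the phase gate.\<close>

lemma rot_in_span_single_z: "rot_in_span (single (i::'m) Z1)"
proof -
  have "(- \<i>)\<^sup>2 * vsign (single i Z1) (single i Z1) = -1"
    by (simp add: vsign_single_xz)
  moreover have "rot (- \<i>) (single i Z1) = smul ((1 - \<i>) / sqrt 2) (on_qubit i phase_s)"
    unfolding rot_def pauli_single_z
    by (auto simp: vec_eq_iff mat_def on_qubit_def pauli_z_def phase_s_def field_simps fun_eq_iff)
  moreover have "cmod ((1 - \<i>) / sqrt 2) = 1"
    by (simp add: norm_divide cmod_def power_divide)
  ultimately show ?thesis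
    unfolding rot_in_span_def using phase_s_in_gate_span[OF card] by (metis gate_span_smul_norm_iff)
qed

text \<open>The global Hadamard turns Z into X, and adding these two anticommuting vectors gives
  Y.\<close>

lemma rot_in_span_single: "rot_in_span (single (i::'m) p)"
proof -
  have "(on_all_qubits hadamard :: 'm qmat) \<in> gate_span"
    by (rule gate_span_gate) (simp add: available_gates_def)
  moreover have "(\<lambda>k. prod.swap (single i Z1 k)) = single i X1"
    by (auto simp: single_def fun_eq_iff)
  hence "maps (on_all_qubits hadamard) (single i Z1) (single i X1)"
    using hadamard_all_pauli[of "single i Z1"] vsign_single_xz[of Z1 i]
    by (intro mapsI[where c = 1]) auto
  ultimately have x: "rot_in_span (single i X1)"
    using rot_in_span_single_z by (rule rot_in_span_maps)
  have "comm (single i X1) (single i Z1) = -1"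
    by (subst comm_single) (simp add: single_def)
  from rot_in_span_add[OF x rot_in_span_single_z this]
  have y: "rot_in_span (vadd (single i X1) (single i Z1))" .
  have "vadd (single i X1) (single i Z1) = single i (True, True)"
    by (auto simp: vadd_def single_def fun_eq_iff)
  with y have "rot_in_span (single i (True, True))" by simp
  moreover have "rot_in_span (single i I1)"
    using rot_in_span_zero by (simp add: single_def fun_upd_idem)
  ultimately show ?thesis
    using x rot_in_span_single_z[of i] by (cases p) (metis (full_types))
qed

text \<open>A CNOT spreads Z from its target to its control; this supplies the two-qubit vectors
  from which larger supports are built.\<close>

lemma rot_in_span_pair_z:
  assumes "i \<noteq> j"
  shows "rot_in_span ((single (i::'m) Z1)(j := Z1))"
proof -
  have "cnot i j \<in> gate_span"
    using assms by (intro gate_span_gate) (auto simp: available_gates_def)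
  moreover have "cnot_pauli i j (single j Z1) = (single i Z1)(j := Z1)"
    using assms by (auto simp: cnot_pauli_def single_def fun_eq_iff)
  hence "maps (cnot i j) (single j Z1) ((single i Z1)(j := Z1))"
    using cnot_mult_pauli[OF assms, of "single j Z1"] by (intro mapsI[where c = 1]) auto
  ultimately show ?thesis
    using rot_in_span_single by (rule rot_in_span_maps)
qed

text \<open>The sum of two distinct nonzero letters anticommutes with both, so adding it at qubit
  \<open>i\<close> is an allowed step that replaces one letter by the other.\<close>

lemma rot_in_span_upd:
  fixes v :: "'m \<Rightarrow> bool \<times> bool"
  assumes v: "rot_in_span v" and "v i \<noteq> I1" "p \<noteq> I1"
  shows "rot_in_span (v(i := p))"
proof (cases "p = v i")
  case True
  thus ?thesis using v by simp
next
  case False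
  have *: "anti q (padd p q)" "padd q (padd p q) = p" "padd r I1 = r"
    if "q \<noteq> I1" "p \<noteq> I1" "p \<noteq> q" for p q r
    using that by (cases p; cases q; cases r; force)+
  have "comm v (single i (padd p (v i))) = -1"
    using *(1) assms False by (simp add: comm_single)
  from rot_in_span_add[OF v rot_in_span_single this]
  have "rot_in_span (vadd v (single i (padd p (v i))))" .
  moreover have "vadd v (single i (padd p (v i))) = v(i := p)"
    using *(2,3) assms False by (auto simp: vadd_def single_def fun_eq_iff)
  ultimately show ?thesis by simp
qed

text \<open>Induction on the size of the support: a vector on two or more qubits is the sum of an
  anticommuting pair, one of smaller support and one on two qubits.\<close>

lemma rot_in_span_all: "rot_in_span (v :: 'm \<Rightarrow> bool \<times> bool)"
proof (induction "card {k. v k \<noteq> I1}" arbitrary: v rule: less_induct)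
  case less
  show ?case
  proof (cases "\<exists>i j. i \<noteq> j \<and> v i \<noteq> I1 \<and> v j \<noteq> I1")
    case False
    show ?thesis
    proof (cases "\<exists>i. v i \<noteq> I1")
      case True
      then obtain i where i: "v i \<noteq> I1" by blast
      have "v k = I1" if "k \<noteq> i" for k using False i that by blast
      hence "v = single i (v i)" by (auto simp: single_def fun_eq_iff)
      thus ?thesis using rot_in_span_single[of i "v i"] by (simp only: flip: \<open>v = _\<close>)
    next
      case False
      hence "v = (\<lambda>_. I1)" by blast
      thus ?thesis using rot_in_span_zero by simp
    qed
  next
    case True
    then obtain i j where ij: "i \<noteq> j" "v i \<noteq> I1" "v j \<noteq> I1" by blast
    \<comment> \<open>Every nonzero letter is the sum of the two other nonzero letters, which
      anticommute.\<close>
    have "\<exists>r. r \<noteq> I1 \<and> padd r q \<noteq> I1 \<and> anti r (padd r q) \<and> padd r (padd r q) = q" if "q \<noteq> I1" for q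
      using that by (cases q) (auto simp: split_paired_Ex ex_bool_eq)
    then obtain r where r: "r \<noteq> I1" "padd r (v i) \<noteq> I1" "anti r (padd r (v i))"
      "padd r (padd r (v i)) = v i"
      using ij by blast
    define u where "u = v(j := I1, i := r)"
    define w where "w = (single i (padd r (v i)))(j := v j)"
    have "{k. u k \<noteq> I1} \<subset> {k. v k \<noteq> I1}"
      using ij by (auto simp: u_def)
    hence "rot_in_span u"
      by (intro less psubset_card_mono) auto
    moreover have "rot_in_span w"
    proof -
      \<comment> \<open>The two-qubit vector arises from the pair of Z letters by changing one
        letter at a time.\<close>
      have "(((single i Z1)(j := Z1))(i := padd r (v i)))(j := v j) = w"
        using ij by (auto simp: w_def single_def fun_eq_iff)
      moreover have "rot_in_span ((((single i Z1)(j := Z1))(i := padd r (v i)))(j := v j))"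
        using ij r by (intro rot_in_span_upd rot_in_span_pair_z) (auto simp: single_def)
      ultimately show ?thesis by simp
    qed
    \<comment> \<open>The supports of \<open>u\<close> and \<open>w\<close> meet only at
      \<open>i\<close>.\<close>
    moreover have "comm u w = -1"
      using ij r by (subst comm_supported[of i]) (auto simp: u_def w_def single_def)
    ultimately have "rot_in_span (vadd u w)" by (rule rot_in_span_add)
    moreover have "padd I1 p = p \<and> padd p I1 = p" for p by (cases p) simp
    hence "vadd u w = v"
      using ij r by (auto simp: vadd_def u_def w_def single_def fun_eq_iff)
    ultimately show ?thesis by simp
  qed
qed

section \<open>Moving Pauli operators by transvections\<close>

text \<open>The transvection along \<open>vadd v u\<close> carries \<open>v\<close> to
  \<open>u\<close>. A vector with equal signs against \<open>v\<close> and \<open>u\<close> commutes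
  with their sum and stays fixed.\<close>

lemma move_anticommuting:
  fixes u v :: "'m \<Rightarrow> bool \<times> bool"
  assumes "comm v u = -1"
  shows "\<exists>B\<in>gate_span. maps B v u \<and> (\<forall>t. comm t v = comm t u \<longrightarrow> maps B t t)"
proof -
  have "comm v (vadd v u) = -1" by (simp add: comm_add assms)
  from rot_maps[OF rot_in_span_all this] obtain B where B: "B \<in> gate_span"
    "maps B v (vadd v (vadd v u))" "\<forall>t. comm t (vadd v u) = 1 \<longrightarrow> maps B t t" by blast
  have "comm t (vadd v u) = 1" if "comm t v = comm t u" for t
    using comm_cases[of t u] that by (auto simp: comm_add)
  thus ?thesis using B by (auto simp: vadd_cancel)
qed

lemma move_via:
  fixes u v y :: "'m \<Rightarrow> bool \<times> bool"
  assumes "comm v y = -1" "comm y u = -1"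
  shows "\<exists>B\<in>gate_span. maps B v u \<and>
    (\<forall>t. comm t v = comm t y \<and> comm t y = comm t u \<longrightarrow> maps B t t)"
proof -
  obtain B where B: "B \<in> gate_span" "maps B v y" "\<forall>t. comm t v = comm t y \<longrightarrow> maps B t t"
    using move_anticommuting[OF assms(1)] by blast
  obtain C where C: "C \<in> gate_span" "maps C y u" "\<forall>t. comm t y = comm t u \<longrightarrow> maps C t t"
    using move_anticommuting[OF assms(2)] by blast
  have "C ** B \<in> gate_span" by (rule gate_span_mult[OF C(1) B(1)])
  moreover have "maps (C ** B) v u" by (rule maps_comp[OF B(2) C(2)])
  moreover have "maps (C ** B) t t" if "comm t v = comm t y \<and> comm t y = comm t u" for t
    using that B(3) C(3) maps_comp[of B t t C t] by blast
  ultimately show ?thesis by blast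
qed

text \<open>If the supports meet, one letter at a common qubit suffices; otherwise one letter is
  placed in each support. Confining \<open>y\<close> to the union of the supports protects qubits
  outside it in \<open>move_nonzero\<close>.\<close>

lemma comm_common:
  assumes "v \<noteq> (\<lambda>_. I1)" "u \<noteq> (\<lambda>_. I1)"
  shows "\<exists>y. comm v y = -1 \<and> comm u y = -1 \<and> (\<forall>k. v k = I1 \<and> u k = I1 \<longrightarrow> y k = I1)"
proof (cases "\<exists>k. v k \<noteq> I1 \<and> u k \<noteq> I1")
  case True
  then obtain k where k: "v k \<noteq> I1" "u k \<noteq> I1" by blast
  have "\<exists>r. anti p r \<and> anti q r" if "p \<noteq> I1" "q \<noteq> I1" for p q
    using that by (cases p; cases q) (auto simp: split_paired_Ex ex_bool_eq)
  with k obtain r where "anti (v k) r" "anti (u k) r" by blast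
  thus ?thesis
    using k by (intro exI[of _ "single k r"]) (auto simp: comm_single, auto simp: single_def)
next
  case False
  obtain k l where k: "v k \<noteq> I1" "u l \<noteq> I1" using assms by blast
  hence kl: "u k = I1" "v l = I1" "k \<noteq> l" using False by auto
  have ex: "\<exists>r. anti p r" if "p \<noteq> I1" for p
    using that by (cases p) (auto simp: split_paired_Ex ex_bool_eq)
  obtain r s where rs: "anti (v k) r" "anti (u l) s" using ex k by meson
  let ?y = "(single k r)(l := s)"
  have "comm v ?y = -1"
    using kl rs by (subst comm_supported[of k]) (auto simp: single_def)
  moreover have "comm u ?y = -1"
    using kl rs by (subst comm_supported[of l]) (auto simp: single_def)
  moreover have "\<forall>k. v k = I1 \<and> u k = I1 \<longrightarrow> ?y k = I1"
    using k by (auto simp: single_def)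
  ultimately show ?thesis by blast
qed

text \<open>The detour through a common anticommuting \<open>y\<close> works whether or not
  \<open>v\<close> and \<open>u\<close> commute.\<close>

lemma move_nonzero:
  fixes u v :: "'m \<Rightarrow> bool \<times> bool"
  assumes "v \<noteq> (\<lambda>_. I1)" "u \<noteq> (\<lambda>_. I1)"
  shows "\<exists>B\<in>gate_span. maps B v u \<and>
    (\<forall>t. (\<forall>k. t k = I1 \<or> (v k = I1 \<and> u k = I1)) \<longrightarrow> maps B t t)"
proof -
  obtain y where y: "comm v y = -1" "comm u y = -1" "\<And>k. v k = I1 \<and> u k = I1 \<Longrightarrow> y k = I1"
    using comm_common[OF assms] by blast
  have "comm y u = -1" using y(2) by (simp add: comm_commute)
  from move_via[OF y(1) this] obtain B where B: "B \<in> gate_span" "maps B v u"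
    "\<forall>t. comm t v = comm t y \<and> comm t y = comm t u \<longrightarrow> maps B t t" by blast
  have "maps B t t" if "\<forall>k. t k = I1 \<or> (v k = I1 \<and> u k = I1)" for t
  proof -
    have "comm t v = 1" "comm t y = 1" "comm t u = 1"
      using that y(3) by (auto intro!: comm_eq_one)
    thus ?thesis using B(3) by simp
  qed
  thus ?thesis using B by blast
qed

text \<open>The second half of aligning a qubit: once \<open>e\<close> is in place, its partner
  \<open>w\<close> is moved to \<open>f\<close> without disturbing \<open>e\<close>.\<close>

lemma move_partner:
  fixes e f w :: "'m \<Rightarrow> bool \<times> bool"
  assumes "comm w e = -1" "comm f e = -1"
  shows "\<exists>B\<in>gate_span. maps B w f \<and> maps B e e \<and>
    (\<forall>t. comm t e = 1 \<and> comm t w = 1 \<and> comm t f = 1 \<longrightarrow> maps B t t)"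
proof (cases "comm w f = -1")
  case True
  from move_anticommuting[OF True] obtain B where B: "B \<in> gate_span" "maps B w f"
    "\<forall>t. comm t w = comm t f \<longrightarrow> maps B t t" by blast
  moreover have "comm e w = comm e f" using assms by (simp add: comm_commute[of e])
  ultimately show ?thesis by (intro bexI[of _ B]) auto
next
  case False
  hence wf: "comm w f = 1" using comm_cases by blast
  \<comment> \<open>This intermediate vector anticommutes with \<open>w\<close>, \<open>f\<close>
    and \<open>e\<close>. Hence both moves exist, and both fix \<open>e\<close>, whose signs against
    \<open>w\<close>, \<open>?y\<close> and \<open>f\<close> agree.\<close>
  let ?y = "vadd e f"
  have y: "comm w ?y = -1" "comm ?y f = -1" "comm e ?y = -1"
    using assms wf by (simp_all add: comm_add comm_commute[of ?y f] comm_commute[of e f])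
  from move_via[OF y(1,2)] obtain B where B: "B \<in> gate_span" "maps B w f"
    "\<forall>t. comm t w = comm t ?y \<and> comm t ?y = comm t f \<longrightarrow> maps B t t" by blast
  moreover have "comm e w = comm e ?y \<and> comm e ?y = comm e f"
    using assms y(3) by (simp add: comm_commute[of e])
  moreover have "comm t ?y = 1" if "comm t e = 1" "comm t f = 1" for t
    using that by (simp add: comm_add)
  ultimately show ?thesis by (intro bexI[of _ B]) auto
qed

lemma gate_span_maps:
  assumes "A \<in> gate_span"
  shows "\<exists>v. maps A u v"
proof -
  obtain t B where A: "A = smul (cis t) B" "B \<in> generate clifford_group available_gates"
    using assms by (auto simp: gate_span_def)
  obtain v where "maps B u v"
    using A(2) generate_clifford clifford_maps by blast
  hence "maps A u v" by (auto simp: maps_def A(1) mult.commute)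
  thus ?thesis by blast
qed

text \<open>Qubits are aligned one by one: first the image of Z is restored, then that of X, by
  moves that fix the qubits already done.\<close>

lemma fix_paulis:
  fixes A :: "'m qmat"
  assumes A: "A \<in> carrier clifford_group" and "finite D"
  shows "\<exists>B\<in>gate_span. \<forall>j\<in>D. \<forall>p\<in>{X1, Z1}. maps (B ** A) (single j p) (single j p)"
  using assms(2)
proof induction
  case empty
  show ?case using gate_span_one by blast
next
  case (insert i D)
  then obtain B where B: "B \<in> gate_span"
    "\<And>j p. j \<in> D \<Longrightarrow> p \<in> {X1, Z1} \<Longrightarrow> maps (B ** A) (single j p) (single j p)" by blast
  let ?C = "B ** A" and ?e = "single i Z1" and ?f = "single i X1"
  have unit: "G ** H \<in> carrier unitary_group" if "G \<in> gate_span" "H \<in> carrier unitary_group" for G H :: "'m qmat"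
    using unitary_mult[OF gate_span_unitary[OF that(1)] that(2)] .
  have UC: "?C \<in> carrier unitary_group"
    by (rule unit[OF B(1) clifford_unitary[OF A]])
  have ex: "\<exists>v. maps ?C u v" for u
    using clifford_maps[OF A, of u] gate_span_maps[OF B(1)] maps_comp by metis
  obtain v where v: "maps ?C ?e v" using ex by blast
  obtain w where w: "maps ?C ?f w" using ex by blast
  have ef: "comm ?e ?f = -1" "comm ?f ?e = -1"
    by (simp_all add: comm_single, simp_all add: single_def)
  have far: "comm (single j p) (single i q) = 1" "comm (single i q) (single j p) = 1"
    if "j \<in> D" for j p q
    using that insert.hyps by (auto intro!: comm_eq_one simp: single_def split: if_splits)
  have "comm v w = -1" using maps_comm[OF UC v w] ef by simp
  hence v0: "v \<noteq> (\<lambda>_. I1)" using comm_eq_one[of v w] by auto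
  have e0: "?e \<noteq> (\<lambda>_. I1)" by (auto simp: single_def fun_eq_iff)
  \<comment> \<open>The action preserves commutation, so \<open>v\<close> commutes with X and Z on
    each finished qubit and is trivial there.\<close>
  have vD: "v j = I1" if "j \<in> D" for j
  proof -
    have "comm v (single j p) = 1" if "p \<in> {X1, Z1}" for p
      using maps_comm[OF UC v B(2)[OF \<open>j \<in> D\<close> that]] far[OF \<open>j \<in> D\<close>] by simp
    from this[of X1] this[of Z1] show ?thesis
      by (cases "v j") (auto simp: comm_single split: if_splits)
  qed
  obtain B1 where B1: "B1 \<in> gate_span" "maps B1 v ?e"
    "\<And>t. (\<And>k. t k = I1 \<or> (v k = I1 \<and> ?e k = I1)) \<Longrightarrow> maps B1 t t"
    using move_nonzero[OF v0 e0] by blast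
  let ?C1 = "B1 ** ?C"
  have UC1: "?C1 \<in> carrier unitary_group" by (rule unit[OF B1(1) UC])
  have e1: "maps ?C1 ?e ?e" by (rule maps_comp[OF v B1(2)])
  have D1: "maps ?C1 (single j p) (single j p)" if "j \<in> D" "p \<in> {X1, Z1}" for j p
  proof (rule maps_comp[OF B(2)[OF that] B1(3)])
    show "single j p k = I1 \<or> (v k = I1 \<and> ?e k = I1)" for k
      using vD[OF that(1)] that(1) insert.hyps by (auto simp: single_def)
  qed
  obtain w1 where w1: "maps ?C1 ?f w1"
    using gate_span_maps[OF B1(1), of w] maps_comp[OF w] by blast
  \<comment> \<open>The current image of X still anticommutes with the restored Z, as
    \<open>move_partner\<close> requires.\<close>
  have "comm w1 ?e = -1" using maps_comm[OF UC1 w1 e1] ef by simp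
  from move_partner[OF this ef(2)] obtain B2 where B2: "B2 \<in> gate_span" "maps B2 w1 ?f" "maps B2 ?e ?e"
    "\<And>t. comm t ?e = 1 \<Longrightarrow> comm t w1 = 1 \<Longrightarrow> comm t ?f = 1 \<Longrightarrow> maps B2 t t" by blast
  let ?C2 = "B2 ** ?C1"
  have "maps ?C2 (single j p) (single j p)" if "j \<in> D" "p \<in> {X1, Z1}" for j p
  proof (rule maps_comp[OF D1[OF that] B2(4)])
    show "comm (single j p) w1 = 1"
      using maps_comm[OF UC1 D1[OF that] w1] far[OF that(1)] by simp
  qed (use far[OF that(1)] in auto)
  moreover have "maps ?C2 ?e ?e" by (rule maps_comp[OF e1 B2(3)])
  moreover have "maps ?C2 ?f ?f" by (rule maps_comp[OF w1 B2(2)])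
  moreover have "?C2 = (B2 ** B1 ** B) ** A" by (simp only: matrix_mul_assoc)
  ultimately have "\<forall>j\<in>insert i D. \<forall>p\<in>{X1, Z1}. maps ((B2 ** B1 ** B) ** A) (single j p) (single j p)"
    by auto
  moreover have "B2 ** B1 ** B \<in> gate_span"
    by (intro gate_span_mult B2(1) B1(1) B(1))
  ultimately show ?case by blast
qed

end

section \<open>Operators commuting with all Pauli operators up to phase\<close>

lemma on_qubit_z_eq_diag_mat: "on_qubit i pauli_z = diag_mat (\<lambda>a. if a i then -1 else 1)"
  by (auto simp: vec_eq_iff diag_mat_def on_qubit_def pauli_z_def fun_eq_iff)

lemma mult_diag_mat_nth: "(A ** diag_mat f) $ a $ b = A $ a $ b * f b"
  unfolding matrix_matrix_mult_def
  by simp (subst sum_single_term[of b], auto simp: diag_mat_def)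

lemma diag_mat_mult_nth: "(diag_mat f ** A) $ a $ b = f a * A $ a $ b"
  unfolding matrix_matrix_mult_def
  by simp (subst sum_single_term[of a], auto simp: diag_mat_def)

lemma on_qubit_x_nth: "on_qubit i pauli_x $ a $ b = (if a = b(i := \<not> b i) then 1 else 0)"
  by (auto simp: on_qubit_def pauli_x_def fun_eq_iff)

lemma mult_x_nth: "(A ** on_qubit i pauli_x) $ a $ b = A $ a $ (b(i := \<not> b i))"
  unfolding matrix_matrix_mult_def
  by simp (subst sum_single_term[of "b(i := \<not> b i)"], auto simp: on_qubit_x_nth)

lemma x_mult_nth: "(on_qubit i pauli_x ** A) $ a $ b = A $ (a(i := \<not> a i)) $ b"
  unfolding matrix_matrix_mult_def
  by simp (subst sum_single_term[of "a(i := \<not> a i)"], auto simp: on_qubit_x_nth)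

text \<open>Commuting with every Z removes the off-diagonal entries; commuting with every X makes
  the diagonal invariant under bit flips, hence constant.\<close>

lemma scalar_if_commutes:
  fixes A :: "('m::finite) qmat"
  assumes X: "\<And>i. A ** on_qubit i pauli_x = on_qubit i pauli_x ** A"
    and Z: "\<And>i. A ** on_qubit i pauli_z = on_qubit i pauli_z ** A"
  shows "\<exists>c. A = smul c (mat 1)"
proof -
  have off: "A $ a $ b = 0" if "a \<noteq> b" for a b
  proof -
    obtain i where i: "a i \<noteq> b i" using \<open>a \<noteq> b\<close> by auto
    have "(A ** on_qubit i pauli_z) $ a $ b = (on_qubit i pauli_z ** A) $ a $ b" using Z by simp
    thus ?thesis
      using i by (auto simp: on_qubit_z_eq_diag_mat mult_diag_mat_nth diag_mat_mult_nth split: if_splits)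
  qed
  have flip: "A $ (a(i := \<not> a i)) $ (a(i := \<not> a i)) = A $ a $ a" for a i
  proof -
    have "(A ** on_qubit i pauli_x) $ (a(i := \<not> a i)) $ a = (on_qubit i pauli_x ** A) $ (a(i := \<not> a i)) $ a"
      using X by simp
    thus ?thesis by (simp add: mult_x_nth x_mult_nth)
  qed
  have diag: "A $ a $ a = A $ b $ b" for a b
  proof -
    \<comment> \<open>Interpolates from \<open>b\<close> to \<open>a\<close>, one bit at a
      time.\<close>
    define m where "m S = (\<lambda>k. if k \<in> S then a k else b k)" for S
    have "A $ m S $ m S = A $ b $ b" if "finite S" for S
      using that
    proof induction
      case (insert i S)
      have "m (insert i S) = m S \<or> m (insert i S) = (m S)(i := \<not> m S i)"
        using insert.hyps by (auto simp: m_def fun_eq_iff)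
      thus ?case using insert.IH flip[of "m S" i] by (elim disjE) (simp_all only:)
    qed (simp add: m_def)
    from this[of UNIV] show ?thesis by (simp add: m_def)
  qed
  \<comment> \<open>The diagonal is constant, so an arbitrary index gives the scalar.\<close>
  have "A = smul (A $ undefined $ undefined) (mat 1)"
    unfolding vec_eq_iff using off diag by (auto simp: mat_def)
  thus ?thesis by blast
qed

text \<open>The remaining signs are those of some Pauli operator; multiplying by it leaves an
  operator that commutes with all X and Z, hence a phase.\<close>

lemma gate_span_if_fixes_paulis:
  fixes A :: "('m::finite) qmat"
  assumes card: "CARD('m) \<ge> 3" and A: "A \<in> carrier unitary_group"
    and fixed: "\<And>i p. p = X1 \<or> p = Z1 \<Longrightarrow> maps A (single i p) (single i p)"
  shows "A \<in> gate_span"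
proof -
  define Q where "Q i p c \<longleftrightarrow>
      A ** pauli (single i p) = smul c (pauli (single i p) ** A) \<and> (c = 1 \<or> c = -1)" for i p c
  have ex: "\<exists>c. Q i p c" if p: "p = X1 \<or> p = Z1" for i :: 'm and p
  proof -
    let ?P = "pauli (single i p)"
    obtain c where c: "A ** ?P = smul c (?P ** A)"
      using fixed[OF p] by (auto simp: maps_def)
    have sq: "?P ** ?P = mat 1"
      by (simp add: pauli_square vsign_single_xz[OF p])
    have "smul 1 A = A ** ?P ** ?P"
      by (simp add: sq flip: matrix_mul_assoc)
    also have "\<dots> = smul (c * c) (?P ** (?P ** A))"
      by (simp add: c) (simp add: c flip: matrix_mul_assoc)
    also have "\<dots> = smul (c * c) A"
      by (simp add: sq matrix_mul_assoc)
    finally have "1 = c * c"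
      by (rule smul_left_eqD[OF _ unitary_nonzero[OF A]])
    hence "c = 1 \<or> c = -1" by (metis square_eq_1_iff)
    thus ?thesis using c unfolding Q_def by blast
  qed
  define c where "c i p = (SOME c. Q i p c)" for i p
  have c: "A ** pauli (single i p) = smul (c i p) (pauli (single i p) ** A)"
    "c i p = 1 \<or> c i p = -1" if "p = X1 \<or> p = Z1" for i p
  proof -
    have "Q i p (c i p)"
      unfolding c_def by (rule someI_ex[OF ex[OF that]])
    thus "A ** pauli (single i p) = smul (c i p) (pauli (single i p) ** A)" "c i p = 1 \<or> c i p = -1"
      unfolding Q_def by blast+
  qed
  \<comment> \<open>An X factor flips the sign of Z and vice versa, so each bit of \<open>y\<close>
    is read off from the sign of the other letter.\<close>
  define y where "y = (\<lambda>i. (c i Z1 = -1, c i X1 = -1))"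
  let ?B = "pauli y ** A"
  have "?B ** pauli (single i p) = pauli (single i p) ** ?B" if p: "p = X1 \<or> p = Z1" for i p
  proof -
    have "comm y (single i p) = c i p"
      using p c(2)[of X1 i] c(2)[of Z1 i] by (auto simp: comm_single y_def)
    moreover have "c i p * c i p = 1" using c(2)[OF p, of i] by auto
    moreover have "?B ** pauli (single i p) = smul (c i p) (pauli y ** pauli (single i p) ** A)"
      using c(1)[OF p, of i] by (simp flip: matrix_mul_assoc)
    ultimately show ?thesis
      by (simp add: pauli_commute[of y]) (simp flip: matrix_mul_assoc)
  qed
  from this[of X1] this[of Z1] obtain d where d: "?B = smul d (mat 1)"
    using scalar_if_commutes[of ?B] by (auto simp: pauli_single_x pauli_single_z)
  have "?B \<in> carrier unitary_group" by (rule unitary_mult[OF pauli_unitary A])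
  hence "smul (cnj d * d) (mat 1 :: 'm qmat) = smul 1 (mat 1)"
    by (simp add: d mult.commute)
  moreover have "(mat 1 :: 'm qmat) \<noteq> 0" by (rule unitary_nonzero) simp
  ultimately have "cnj d * d = 1" by (rule smul_left_eqD)
  hence "(cmod d)\<^sup>2 = 1"
    using complex_norm_square[of d] by (simp add: mult.commute) (metis of_real_eq_1_iff of_real_power)
  hence "cmod d = 1" by (simp add: power2_eq_1_iff) (use norm_ge_zero[of d] in linarith)
  hence B: "?B \<in> gate_span" unfolding d by (simp only: gate_span_smul_norm_iff gate_span_one)
  have "pauli y \<in> gate_span"
    by (rule pauli_in_gate_span[OF rot_in_span_all[OF card]])
  from gate_span_mult[OF gate_span_dagger[OF this] B]
  have "dagger (pauli y) ** ?B \<in> gate_span" .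
  moreover have "dagger (pauli y) ** pauli y = mat 1"
    using pauli_unitary[of y] by simp
  ultimately show ?thesis by (simp add: matrix_mul_assoc)
qed

section \<open>Generation of the Clifford group and passage to the quotient\<close>

lemma clifford_subset_gate_span:
  assumes card: "CARD('m::finite) \<ge> 3"
  shows "carrier clifford_group \<subseteq> (gate_span :: 'm qmat set)"
proof
  fix A :: "'m qmat" assume A: "A \<in> carrier clifford_group"
  obtain B where B: "B \<in> gate_span"
    "\<forall>j\<in>UNIV. \<forall>p\<in>{X1, Z1}. maps (B ** A) (single j p) (single j p)"
    using fix_paulis[OF card A, of UNIV] by auto
  note UB = gate_span_unitary[OF B(1)]
  have "B ** A \<in> gate_span"
    using B(2) by (intro gate_span_if_fixes_paulis[OF card] unitary_mult[OF UB clifford_unitary[OF A]]) auto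
  from gate_span_mult[OF gate_span_dagger[OF B(1)] this]
  have "dagger B ** (B ** A) \<in> gate_span" .
  moreover have "dagger B ** B = mat 1" using UB by simp
  ultimately show "A \<in> gate_span" by (simp add: matrix_mul_assoc)
qed

theorem mainTheorem10:
  assumes "CARD('m::finite) \<ge> 3"
  shows "available_gates \<subseteq> carrier (clifford_group :: 'm qmat monoid)
    \<and> generate (clifford_group Mod global_phases)
        ((\<lambda>g. global_phases #>\<^bsub>clifford_group\<^esub> g) ` (available_gates :: 'm qmat set))
      = carrier ((clifford_group :: 'm qmat monoid) Mod global_phases)"
proof
  let ?C = "clifford_group :: 'm qmat monoid"
  let ?N = "global_phases :: 'm qmat set"
  let ?h = "\<lambda>g. ?N #>\<^bsub>?C\<^esub> g"
  show gates: "available_gates \<subseteq> carrier ?C" by (rule available_gates_clifford)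
  have sub: "subgroup ?N ?C" by (rule normal_imp_subgroup[OF normal_global_phases])
  have hom: "group_hom ?C (?C Mod ?N) ?h"
    by (intro group_hom.intro group_hom_axioms.intro group_clifford_group
        group_clifford_mod_phases normal.r_coset_hom_Mod[OF normal_global_phases])
  have "carrier (?C Mod ?N) = ?h ` carrier ?C"
    by (auto simp: FactGroup_def RCOSETS_def)
  also have "\<dots> = ?h ` generate ?C available_gates"
  proof
    show "?h ` carrier ?C \<subseteq> ?h ` generate ?C available_gates"
    proof (rule image_subsetI)
      fix A assume "A \<in> carrier ?C"
      hence "A \<in> gate_span" using clifford_subset_gate_span[OF assms] by blast
      then obtain t B where A: "A = smul (cis t) B" and B: "B \<in> generate ?C available_gates"
        by (auto simp: gate_span_def)
      have BC: "B \<in> carrier ?C" using B generate_clifford by blast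
      have tN: "mat (cis t) \<in> ?N" by (auto simp: global_phases_def)
      have tC: "mat (cis t) \<in> carrier ?C" using subgroup.subset[OF sub] tN by blast
      \<comment> \<open>The two operators differ by a global phase, so their cosets
        coincide.\<close>
      have "A = mat (cis t) \<otimes>\<^bsub>?C\<^esub> B"
        by (simp add: A clifford_group_def mat_eq_smul[of "cis t"])
      hence "?h A = ?h (mat (cis t)) #>\<^bsub>?C\<^esub> B"
        using group.coset_mult_assoc[OF group_clifford_group subgroup.subset[OF sub] tC BC] by simp
      also have "?h (mat (cis t)) = ?N"
        by (rule group.coset_join2[OF group_clifford_group tC sub tN])
      finally show "?h A \<in> ?h ` generate ?C available_gates" using B by blast
    qed
    show "?h ` generate ?C available_gates \<subseteq> ?h ` carrier ?C"
      by (rule image_mono[OF generate_clifford])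
  qed
  \<comment> \<open>A homomorphism maps a generated subgroup to the one generated by the
    images.\<close>
  also have "\<dots> = generate (?C Mod ?N) (?h ` available_gates)"
    by (rule group_hom.generate_img[OF hom gates, symmetric])
  finally show "generate (?C Mod ?N) (?h ` available_gates) = carrier (?C Mod ?N)" ..
qed

end
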